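(* Let $\mathbb{G}$ be a pseudo-orientable ribbon graph and let $Q$ be a quasi-tree of $\mathbb{G}$. Then there is an integral principally unimodular square matrix $\mathbf{M}$, with rows and columns indexed by $E(\mathbb{G})$, such that for every $X\subseteq E(\mathbb{G})$, \[\det(\mathbf{M}[Q\triangle X])=\begin{cases}1 & \text{if } X \text{ is a quasi-tree of } \mathbb{G},\\ 0 & \text{otherwise.}\end{cases}\] In particular, $\det(\mathbf{I}+\mathbf{M})$ equals the number of quasi-trees of $\mathbb{G}$.
   Context: A ribbon graph $\mathbb{G}$ is a surface with boundary written as the union of vertex discs $V(\mathbb{G})$ and edge discs $E(\mathbb{G})$, where vertices and edges meet in disjoint line segments, each on the boundary of exactly one vertex and one edge, and each edge contains exactly two such segments. For a connected ribbon graph, a quasi-tree is $F\subseteq E(\mathbb{G})$ such that the spanning ribbon subgraph $(V(\mathbb{G}),F)$ has exactly one boundary component; in general, a quasi-tree is a union of quasi-trees of the components. For $X\subseteq E(\mathbb{G})$ the partial dual $\mathbb{G}^X$ has the same edges and has as vertices discs glued along the boundary components of $(V(\mathbb{G}),X)$ (old vertices discarded). A bouquet is a ribbon graph with one vertex; a loop $e$ is orientable if $v\cup e$ is an annulus, non-orientable if it is a Möbius band. A bouquet is pseudo-orientable if its vertex boundary circle is the union of two closed arcs $S_1,S_2$ meeting in exactly two points such that both ends of each orientable loop lie in the interior of a single $S_i$ and each non-orientable loop has one end in the interior of $S_1$ and one in the interior of $S_2$. A connected ribbon graph is pseudo-orientable if $\mathbb{G}^X$ is a pseudo-orientable bouquet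 for some quasi-tree $X$; a general ribbon graph is pseudo-orientable if one component is pseudo-orientable and all others are orientable. $\mathbf{M}[Y]$ denotes the principal submatrix indexed by $Y$, with $\det(\mathbf{M}[\emptyset])=1$. A matrix is principally unimodular (PU) if all its principal minors lie in $\{0,\pm1\}$. *)

theory Defs
  imports "HOL-Combinatorics.Permutations"
begin

text \<open>Combinatorial (arrow/corner) model of ribbon graphs.
  Points: the four corners of each edge disc (endpoints of its two attaching segments).
  nu pairs the two endpoints of the same attaching segment; ep pairs the two endpoints
  of the same long (non-attaching) side of the edge; sg pairs the two endpoints of each
  free arc of a vertex boundary circle.  iso counts vertices without any edge.\<close>

record ('p, 'e) rgraph =
  pts :: "'p set"
  edg :: "'p \<Rightarrow> 'e"
  sg  :: "'p \<Rightarrow> 'p"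
  nu  :: "'p \<Rightarrow> 'p"
  ep  :: "'p \<Rightarrow> 'p"
  iso :: nat

definition fpf_inv_on :: "'p set \<Rightarrow> ('p \<Rightarrow> 'p) \<Rightarrow> bool" where
  "fpf_inv_on P f \<longleftrightarrow> (\<forall>p\<in>P. f p \<in> P \<and> f (f p) = p \<and> f p \<noteq> p)"

definition rgraph_wf :: "('p, 'e) rgraph \<Rightarrow> bool" where
  "rgraph_wf G \<longleftrightarrow> finite (pts G)
     \<and> fpf_inv_on (pts G) (sg G) \<and> fpf_inv_on (pts G) (nu G) \<and> fpf_inv_on (pts G) (ep G)
     \<and> (\<forall>p\<in>pts G. edg G (nu G p) = edg G p \<and> edg G (ep G p) = edg G p
          \<and> nu G (ep G p) = ep G (nu G p) \<and> nu G p \<noteq> ep G p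
          \<and> card {q\<in>pts G. edg G q = edg G p} = 4)"

definition E :: "('p, 'e) rgraph \<Rightarrow> 'e set" where
  "E G = edg G ` pts G"

text \<open>Orbits of the group generated by a set of (involutive) maps on P.\<close>
definition orbs :: "'p set \<Rightarrow> ('p \<Rightarrow> 'p) set \<Rightarrow> 'p set set" where
  "orbs P fs = P // ({(p, f p) | p f. p \<in> P \<and> f \<in> fs}\<^sup>*)"

definition nverts :: "('p, 'e) rgraph \<Rightarrow> nat" where
  "nverts G = card (orbs (pts G) {sg G, nu G}) + iso G"

definition nbound :: "('p, 'e) rgraph \<Rightarrow> nat" where
  "nbound G = card (orbs (pts G) {sg G, ep G}) + iso G"

text \<open>Point sets of the components having at least one edge; the remaining
  components are the iso G isolated vertices.\<close>
definition comps :: "('p, 'e) rgraph \<Rightarrow> 'p set set" where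
  "comps G = orbs (pts G) {sg G, nu G, ep G}"

definition ncomps :: "('p, 'e) rgraph \<Rightarrow> nat" where
  "ncomps G = card (comps G) + iso G"

definition connected_rg :: "('p, 'e) rgraph \<Rightarrow> bool" where
  "connected_rg G \<longleftrightarrow> ncomps G = 1"

text \<open>The component of G with point set C (C in comps G), as a ribbon graph.\<close>
definition restrict_rg :: "('p, 'e) rgraph \<Rightarrow> 'p set \<Rightarrow> ('p, 'e) rgraph" where
  "restrict_rg G C = G\<lparr>pts := C, iso := 0\<rparr>"

text \<open>An isolated vertex (as a ribbon graph).\<close>
definition single_vertex :: "('p, 'e) rgraph \<Rightarrow> ('p, 'e) rgraph" where
  "single_vertex G = G\<lparr>pts := {}, iso := 1\<rparr>"

text \<open>Spanning ribbon subgraph (V(G), F): delete the edges not in F.  The free arcs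
  of the vertex boundaries merge across the attaching segments of deleted edges;
  vertices all of whose edges are deleted become isolated.\<close>
definition sub_rg :: "('p, 'e) rgraph \<Rightarrow> 'e set \<Rightarrow> ('p, 'e) rgraph" where
  "sub_rg G F = G\<lparr>pts := {p\<in>pts G. edg G p \<in> F},
     sg := (\<lambda>p. let n = (LEAST n. edg G (((sg G \<circ> nu G) ^^ n) (sg G p)) \<in> F)
                in ((sg G \<circ> nu G) ^^ n) (sg G p)),
     iso := iso G + card {C \<in> orbs (pts G) {sg G, nu G}. \<forall>p\<in>C. edg G p \<notin> F}\<rparr>"

text \<open>Partial dual G^X (Chmutov): on the edges of X the roles of the attaching
  segments and the long sides are exchanged.\<close>
definition pdual :: "('p, 'e) rgraph \<Rightarrow> 'e set \<Rightarrow> ('p, 'e) rgraph" where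
  "pdual G X = G\<lparr>nu := (\<lambda>p. if edg G p \<in> X then ep G p else nu G p),
                  ep := (\<lambda>p. if edg G p \<in> X then nu G p else ep G p)\<rparr>"

text \<open>Orientability of the surface: the corner graph (edges sg, nu, ep) is bipartite.\<close>
definition orientable_rg :: "('p, 'e) rgraph \<Rightarrow> bool" where
  "orientable_rg G \<longleftrightarrow> (\<exists>c :: 'p \<Rightarrow> bool. \<forall>p\<in>pts G.
      c (sg G p) \<noteq> c p \<and> c (nu G p) \<noteq> c p \<and> c (ep G p) \<noteq> c p)"

text \<open>Quasi-trees.\<close>
definition qtree_conn :: "('p, 'e) rgraph \<Rightarrow> 'e set \<Rightarrow> bool" where
  "qtree_conn G X \<longleftrightarrow> X \<subseteq> E G \<and> nbound (sub_rg G X) = 1"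

definition qtree :: "('p, 'e) rgraph \<Rightarrow> 'e set \<Rightarrow> bool" where
  "qtree G X \<longleftrightarrow> X \<subseteq> E G \<and>
     (\<forall>C\<in>comps G. qtree_conn (restrict_rg G C) (X \<inter> E (restrict_rg G C)))"

text \<open>Loop e of a bouquet is orientable iff v \<union> e (= sub-ribbon graph on {e}) is orientable.\<close>
definition orientable_loop :: "('p, 'e) rgraph \<Rightarrow> 'e \<Rightarrow> bool" where
  "orientable_loop G e \<longleftrightarrow> orientable_rg (sub_rg G {e})"

text \<open>Pseudo-orientable bouquet: s p says whether corner p lies on S1 (True) or S2;
  each attaching segment (nu-pair) lies in one arc, the two cut points lie on free
  arcs (sg-pairs), so at most two free arcs change label, i.e. at most 4 corners p
  with s (sg p) \<noteq> s p.  Both ends of an edge are {p, nu p} and {ep p, nu (ep p)}.\<close>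
definition po_bouquet :: "('p, 'e) rgraph \<Rightarrow> bool" where
  "po_bouquet G \<longleftrightarrow> nverts G = 1 \<and>
     (\<exists>s :: 'p \<Rightarrow> bool.
        (\<forall>p\<in>pts G. s (nu G p) = s p)
      \<and> card {p\<in>pts G. s (sg G p) \<noteq> s p} \<le> 4
      \<and> (\<forall>p\<in>pts G. orientable_loop G (edg G p) \<longrightarrow> s (ep G p) = s p)
      \<and> (\<forall>p\<in>pts G. \<not> orientable_loop G (edg G p) \<longrightarrow> s (ep G p) \<noteq> s p))"

definition conn_pseudo_orientable :: "('p, 'e) rgraph \<Rightarrow> bool" where
  "conn_pseudo_orientable G \<longleftrightarrow> connected_rg G \<and>
     (\<exists>X. qtree G X \<and> po_bouquet (pdual G X))"

definition pseudo_orientable :: "('p, 'e) rgraph \<Rightarrow> bool" where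
  "pseudo_orientable G \<longleftrightarrow>
     (\<exists>C\<in>comps G. conn_pseudo_orientable (restrict_rg G C) \<and>
        (\<forall>C'\<in>comps G - {C}. orientable_rg (restrict_rg G C')))
   \<or> (iso G > 0 \<and> conn_pseudo_orientable (single_vertex G) \<and>
        (\<forall>C\<in>comps G. orientable_rg (restrict_rg G C)))"

text \<open>Principal minors of a matrix with rows/columns indexed by elements of 'e:
  pdet M Y = det (M[Y]) by the Leibniz formula; pdet M {} = 1.\<close>
definition pdet :: "('e \<Rightarrow> 'e \<Rightarrow> int) \<Rightarrow> 'e set \<Rightarrow> int" where
  "pdet M Y = (\<Sum>p | p permutes Y. sign p * (\<Prod>i\<in>Y. M i (p i)))"

definition principally_unimodular :: "('e \<Rightarrow> 'e \<Rightarrow> int) \<Rightarrow> 'e set \<Rightarrow> bool" where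
  "principally_unimodular M I \<longleftrightarrow> (\<forall>Y\<subseteq>I. pdet M Y \<in> {-1, 0, 1})"

end

theory Submission
  imports Defs "Jordan_Normal_Form.Determinant"
begin

text \<open>Write \<open>nu\<^sub>X\<close> for \<open>ep\<close> on the edges of \<open>X\<close> and \<open>nu\<close> elsewhere.  The boundary components of
  \<open>(V, X)\<close> are the orbits of \<open>sg\<close> and \<open>nu\<^sub>X\<close>, so \<open>X\<close> is a quasi-tree iff every component is a single
  orbit.  If the corners are 2-coloured such that all three involutions change the colour, then
  these orbits are the cycles of the permutation \<open>sg \<circ> nu\<^sub>X\<close> on one colour class; choosing a root in
  every component and deleting the root rows from its matrix gives a matrix \<open>S\<^sub>X\<close> with
  \<open>det S\<^sub>X = 1\<close> if \<open>X\<close> is a quasi-tree and \<open>0\<close> otherwise.  In the pseudo-orientable case the colouring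
  fails at two \<open>sg\<close>-pairs only; these can be reconnected in two ways, exactly one of which preserves
  the orbits, and the sum of the two determinants is again one determinant \<open>det S\<^sub>X\<close>.
  In both cases \<open>S\<^sub>X = S\<^sub>Q + W\<^sub>Y V\<^sub>Y\<close> with \<open>Y = Q \<triangle> X\<close>, where \<open>W\<^sub>Y\<close> and \<open>V\<^sub>Y\<close> consist of the columns and
  rows indexed by \<open>Y\<close> of fixed integral matrices \<open>W\<close> and \<open>V\<close>.  As \<open>det S\<^sub>Q = 1\<close>, Sylvester's identity
  shows that \<open>M = 1 + V S\<^sub>Q\<^sup>-\<^sup>1 W\<close> is integral with \<open>det M[Y] = det S\<^sub>X\<close>.\<close>

section \<open>Principal minors\<close>

text \<open>Conjugation by \<open>f\<close> matches the permutations of \<open>{0..<n}\<close> with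
  those of \<open>Y\<close> and keeps their signs; results on \<open>det\<close> thus transfer to
  minors indexed by any finite set.\<close>

lemma pdet_eq_det:
  fixes M :: "'i \<Rightarrow> 'i \<Rightarrow> int"
  assumes f: "bij_betw f {0..<n} Y"
  shows "pdet M Y = det (mat n n (\<lambda>(i, j). M (f i) (f j)))"
proof -
  have inj: "inj_on f {0..<n}" and im: "f ` {0..<n} = Y"
    using f by (auto simp: bij_betw_def)
  let ?h = "map_permutation {0..<n} f"
  have bij: "bij_betw ?h {p. p permutes {0..<n}} {p. p permutes Y}"
  proof (rule bij_betw_byWitness[where f' = "map_permutation Y (inv_into {0..<n} f)"])
    show "\<forall>p\<in>{p. p permutes {0..<n}}. map_permutation Y (inv_into {0..<n} f) (?h p) = p"
      using f by (auto intro!: map_permutation_compose_inv simp: inv_into_f_f[OF inj])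
    show "\<forall>p\<in>{p. p permutes Y}. ?h (map_permutation Y (inv_into {0..<n} f) p) = p"
      using f bij_betw_inv_into[OF f]
      by (auto intro!: map_permutation_compose_inv simp: f_inv_into_f im)
    show "?h ` {p. p permutes {0..<n}} \<subseteq> {p. p permutes Y}"
      using map_permutation_permutes[OF f] by auto
    show "map_permutation Y (inv_into {0..<n} f) ` {p. p permutes Y} \<subseteq> {p. p permutes {0..<n}}"
      using map_permutation_permutes[OF bij_betw_inv_into[OF f]] by auto
  qed
  have "pdet M Y = (\<Sum>p | p permutes {0..<n}. sign (?h p) * (\<Prod>i\<in>Y. M i (?h p i)))"
    unfolding pdet_def by (rule sum.reindex_bij_betw[OF bij, symmetric])
  also have "\<dots> = (\<Sum>p | p permutes {0..<n}. sign p * (\<Prod>i=0..<n. M (f i) (f (p i))))"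
  proof (rule sum.cong[OF refl])
    fix p assume "p \<in> {p. p permutes {0..<n}}"
    then have p: "p permutes {0..<n}" by simp
    have "(\<Prod>i\<in>Y. M i (?h p i)) = (\<Prod>i=0..<n. M (f i) (?h p (f i)))"
      by (rule prod.reindex_bij_betw[OF f, symmetric])
    then show "sign (?h p) * (\<Prod>i\<in>Y. M i (?h p i)) = sign p * (\<Prod>i=0..<n. M (f i) (f (p i)))"
      using sign_map_permutation[OF inj p] map_permutation_apply[OF inj] by simp
  qed
  also have "\<dots> = det (mat n n (\<lambda>(i, j). M (f i) (f j)))"
    unfolding det_def
    by (auto intro!: sum.cong prod.cong dest: permutes_in_image)
  finally show ?thesis .
qed

lemma pdet_eq_0_if_kernel:
  assumes I: "finite I" and k: "k \<in> I" "v k \<noteq> 0"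
    and ker: "\<And>i. i \<in> I \<Longrightarrow> (\<Sum>j\<in>I. M i j * v j) = 0"
  shows "pdet M I = 0"
proof -
  obtain f where f: "bij_betw f {0..<card I} I"
    using ex_bij_betw_nat_finite[OF I] by blast
  let ?A = "mat (card I) (card I) (\<lambda>(i, j). M (f i) (f j))"
  let ?v = "vec (card I) (\<lambda>i. v (f i))"
  have "k \<in> f ` {0..<card I}" using f k by (simp add: bij_betw_def)
  then obtain k' where k': "k' < card I" "f k' = k" by auto
  have "?v \<noteq> 0\<^sub>v (card I)"
    using k' k by (metis index_vec index_zero_vec(1))
  moreover have "?A *\<^sub>v ?v = 0\<^sub>v (card I)"
  proof (rule eq_vecI)
    fix i assume i: "i < dim_vec (0\<^sub>v (card I) :: int vec)"
    have "(\<Sum>j=0..<card I. M (f i) (f j) * v (f j)) = (\<Sum>j\<in>I. M (f i) j * v j)"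
      by (rule sum.reindex_bij_betw[OF f])
    also have "\<dots> = 0"
      using ker[of "f i"] bij_betwE[OF f] i by auto
    finally show "(?A *\<^sub>v ?v) $ i = 0\<^sub>v (card I) $ i"
      using i by (simp add: scalar_prod_def)
  qed simp
  ultimately have "det ?A = 0"
    by (subst det_0_iff_vec_prod_zero[of _ "card I"]) (auto intro!: exI[of _ ?v])
  then show ?thesis
    by (simp add: pdet_eq_det[OF f])
qed

lemma pdet_cong:
  assumes "\<And>i j. i \<in> I \<Longrightarrow> j \<in> I \<Longrightarrow> M i j = N i j"
  shows "pdet M I = pdet N I"
  unfolding pdet_def
  by (intro sum.cong refl arg_cong2[where f = "(*)"] prod.cong)
     (auto simp: assms permutes_in_image)

text \<open>Each Leibniz term has exactly one factor from row \<open>a\<close>. In the twisted case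
  this merges the determinants of the two reconnections into one.\<close>

lemma pdet_row_add:
  assumes I: "finite I" and a: "a \<in> I"
    and M: "\<And>j. j \<in> I \<Longrightarrow> M a j = M1 a j + M2 a j"
    and M1: "\<And>i j. i \<in> I \<Longrightarrow> i \<noteq> a \<Longrightarrow> j \<in> I \<Longrightarrow> M1 i j = M i j"
    and M2: "\<And>i j. i \<in> I \<Longrightarrow> i \<noteq> a \<Longrightarrow> j \<in> I \<Longrightarrow> M2 i j = M i j"
  shows "pdet M I = pdet M1 I + pdet M2 I"
  unfolding pdet_def sum.distrib[symmetric]
proof (rule sum.cong[OF refl])
  fix p assume "p \<in> {p. p permutes I}"
  then have p: "\<And>i. i \<in> I \<Longrightarrow> p i \<in> I" by (auto simp: permutes_in_image)
  have "(\<Prod>i\<in>I - {a}. M1 i (p i)) = (\<Prod>i\<in>I - {a}. M i (p i))"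
       "(\<Prod>i\<in>I - {a}. M2 i (p i)) = (\<Prod>i\<in>I - {a}. M i (p i))"
    by (auto intro!: prod.cong simp: M1 M2 p)
  then show "sign p * (\<Prod>i\<in>I. M i (p i)) =
      sign p * (\<Prod>i\<in>I. M1 i (p i)) + sign p * (\<Prod>i\<in>I. M2 i (p i))"
    by (simp add: prod.remove[OF I a] M p a algebra_simps)
qed

text \<open>Expanding the product over the rows chooses a set \<open>Y\<close> of rows that use
  \<open>M\<close>; the other rows use the identity, so a contributing permutation fixes everything
  outside \<open>Y\<close>.\<close>

lemma pdet_one_plus:
  assumes I: "finite I"
  shows "pdet (\<lambda>i j. (if i = j then 1 else 0) + M i j) I = (\<Sum>Y\<in>Pow I. pdet M Y)"
proof -
  have fin: "finite {p. p permutes I}" using I by (rule finite_permutations)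
  have "pdet (\<lambda>i j. (if i = j then 1 else 0) + M i j) I =
      (\<Sum>p | p permutes I. \<Sum>Y\<in>Pow I.
        sign p * ((\<Prod>i\<in>Y. M i (p i)) * (\<Prod>i\<in>I - Y. if i = p i then 1 else 0)))"
    unfolding pdet_def
    by (subst add.commute) (simp add: prod_add[OF I] sum_distrib_left)
  also have "\<dots> = (\<Sum>Y\<in>Pow I. \<Sum>p | p permutes I.
        sign p * ((\<Prod>i\<in>Y. M i (p i)) * (\<Prod>i\<in>I - Y. if i = p i then 1 else 0)))"
    by (rule sum.swap)
  also have "\<dots> = (\<Sum>Y\<in>Pow I. pdet M Y)"
  proof (rule sum.cong[OF refl])
    fix Y assume "Y \<in> Pow I"
    then have Y: "Y \<subseteq> I" by simp
    let ?t = "\<lambda>p. sign p * ((\<Prod>i\<in>Y. M i (p i)) * (\<Prod>i\<in>I - Y. if i = p i then 1 else 0))"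
    have zero: "?t p = 0" if pI: "p permutes I" and pY: "\<not> p permutes Y" for p
    proof -
      obtain i where "i \<in> I - Y" "i \<noteq> p i"
        using pI pY permutes_superset[of p I Y] by metis
      then have "(\<Prod>i\<in>I - Y. if i = p i then 1 else 0 :: int) = 0"
        using I by (intro prod_zero) (auto intro!: bexI[of _ i])
      then show ?thesis by simp
    qed
    have "(\<Sum>p | p permutes I. ?t p) = (\<Sum>p | p permutes Y. ?t p)"
      by (rule sum.mono_neutral_right[OF fin]) (use zero permutes_subset[OF _ Y] in auto)
    also have "\<dots> = pdet M Y"
      unfolding pdet_def
    proof (rule sum.cong[OF refl])
      fix p assume "p \<in> {p. p permutes Y}"
      then have "(\<Prod>i\<in>I - Y. if i = p i then 1 else 0 :: int) = 1"
        by (intro prod.neutral) (auto dest: permutes_not_in)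
      then show "?t p = sign p * (\<Prod>i\<in>Y. M i (p i))" by simp
    qed
    finally show "(\<Sum>p | p permutes I. ?t p) = pdet M Y" .
  qed
  finally show ?thesis .
qed

text \<open>Both sides are the determinant of the block matrix \<open>?B\<close>: multiplying by
  \<open>?U\<close> on the right clears the lower left block and leaves \<open>S + W * V\<close>;
  multiplying by \<open>?L\<close> on the left clears the same block and leaves \<open>S\<close> and
  its Schur complement.\<close>

lemma det_add_mult_unimodular:
  fixes S :: "'a :: idom mat"
  assumes S: "S \<in> carrier_mat n n" and R: "R \<in> carrier_mat n n" and RS: "R * S = 1\<^sub>m n"
    and W: "W \<in> carrier_mat n m" and V: "V \<in> carrier_mat m n" and det: "det S = 1"
  shows "det (S + W * V) = det (1\<^sub>m m + V * R * W)"
proof -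
  let ?B = "four_block_mat S (- W) V (1\<^sub>m m)"
  let ?L = "four_block_mat (1\<^sub>m n) (0\<^sub>m n m) (- (V * R)) (1\<^sub>m m)"
  let ?U = "four_block_mat (1\<^sub>m n) (0\<^sub>m n m) (- V) (1\<^sub>m m)"
  have B: "?B \<in> carrier_mat (n + m) (n + m)" using S V W by auto
  have U: "?U \<in> carrier_mat (n + m) (n + m)" using V by auto
  have L: "?L \<in> carrier_mat (n + m) (n + m)" using V R by auto
  have detU: "det ?U = 1" and detL: "det ?L = 1"
    using V R by (subst det_four_block_mat_upper_right_zero[of _ n _ m]; auto)+
  have "?B * ?U = four_block_mat (S + W * V) (- W) (0\<^sub>m m n) (1\<^sub>m m)"
    using S V W by (subst mult_four_block_mat[of _ n n _ m _ m _ _ n _ m]) auto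
  then have "det (?B * ?U) = det (S + W * V)"
    using S V W by (simp add: det_four_block_mat_lower_left_zero[of _ n _ m])
  moreover have "?L * ?B = four_block_mat S (- W) (0\<^sub>m m n) (1\<^sub>m m + V * R * W)"
  proof -
    have "V * R * S = V" using V R S RS by (simp add: assoc_mult_mat[of V m n R n S n])
    then show ?thesis
      using S V W R by (subst mult_four_block_mat[of _ n n _ m _ m _ _ n _ m])
        (auto simp: comm_add_mat[of _ m m])
  qed
  then have "det (?L * ?B) = det (1\<^sub>m m + V * R * W)"
    using S V W R det by (simp add: det_four_block_mat_lower_left_zero[of _ n _ m])
  ultimately show ?thesis
    using detU detL by (simp add: det_mult[OF B U] det_mult[OF L B])
qed

text \<open>The submatrix of \<open>1 + V * R * W\<close> on \<open>Y\<close> involves only the rows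
  of \<open>V\<close> and the columns of \<open>W\<close> indexed by \<open>Y\<close>; hence a
  single \<open>M\<close>, fixed before \<open>Y\<close>, serves all \<open>Y\<close> at
  once.\<close>

lemma pdet_low_rank_update:
  fixes S :: "'i \<Rightarrow> 'i \<Rightarrow> int" and W :: "'i \<Rightarrow> 'e \<Rightarrow> int" and V :: "'e \<Rightarrow> 'i \<Rightarrow> int"
  assumes I: "finite I" and det: "pdet S I = 1"
  shows "\<exists>M. \<forall>Y. finite Y \<longrightarrow> pdet M Y = pdet (\<lambda>x z. S x z + (\<Sum>e\<in>Y. W x e * V e z)) I"
proof -
  define n where "n = card I"
  obtain f where f: "bij_betw f {0..<n} I"
    unfolding n_def using ex_bij_betw_nat_finite[OF I] by blast
  define A where "A = mat n n (\<lambda>(i, j). S (f i) (f j))"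
  have A: "A \<in> carrier_mat n n" by (simp add: A_def)
  have detA: "det A = 1" using det by (simp add: A_def pdet_eq_det[OF f])
  \<comment> \<open>The adjugate is integral, and it is the inverse because
    \<open>det A = 1\<close>; so \<open>M\<close> stays integral.\<close>
  define R where "R = adj_mat A"
  have "(1 :: int) \<cdot>\<^sub>m 1\<^sub>m n = 1\<^sub>m n" by (rule eq_matI) auto
  then have R: "R \<in> carrier_mat n n" and RA: "R * A = 1\<^sub>m n"
    using adj_mat[OF A] by (simp_all add: R_def detA)
  define M where "M e e' = (if e = e' then 1 else 0) +
     (\<Sum>k=0..<n. (\<Sum>i=0..<n. V e (f i) * R $$ (i, k)) * W (f k) e')" for e e'
  have "pdet M Y = pdet (\<lambda>x z. S x z + (\<Sum>e\<in>Y. W x e * V e z)) I" if Y: "finite Y" for Y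
  proof -
    define m where "m = card Y"
    obtain g where g: "bij_betw g {0..<m} Y"
      unfolding m_def using ex_bij_betw_nat_finite[OF Y] by blast
    define WY where "WY = mat n m (\<lambda>(i, j). W (f i) (g j))"
    define VY where "VY = mat m n (\<lambda>(i, j). V (g i) (f j))"
    have WY: "WY \<in> carrier_mat n m" and VY: "VY \<in> carrier_mat m n"
      by (simp_all add: WY_def VY_def)
    have "mat m m (\<lambda>(i, j). M (g i) (g j)) = 1\<^sub>m m + VY * R * WY"
    proof (rule eq_matI)
      fix i j assume "i < dim_row (1\<^sub>m m + VY * R * WY)" "j < dim_col (1\<^sub>m m + VY * R * WY)"
      then have ij: "i < m" "j < m" using WY VY by auto
      have "g i = g j \<longleftrightarrow> i = j"
        using g ij by (auto simp: bij_betw_def inj_on_def)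
      then show "mat m m (\<lambda>(i, j). M (g i) (g j)) $$ (i, j) = (1\<^sub>m m + VY * R * WY) $$ (i, j)"
        using ij R by (simp add: M_def WY_def VY_def scalar_prod_def)
    qed (use WY VY R in auto)
    then have "pdet M Y = det (1\<^sub>m m + VY * R * WY)"
      by (simp add: pdet_eq_det[OF g])
    also have "\<dots> = det (A + WY * VY)"
      by (rule det_add_mult_unimodular[OF A R RA WY VY detA, symmetric])
    also have "A + WY * VY = mat n n (\<lambda>(i, j). S (f i) (f j) + (\<Sum>e\<in>Y. W (f i) e * V e (f j)))"
      by (rule eq_matI)
        (auto simp: A_def WY_def VY_def scalar_prod_def sum.reindex_bij_betw[OF g, symmetric])
    also have "det \<dots> = pdet (\<lambda>x z. S x z + (\<Sum>e\<in>Y. W x e * V e z)) I"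
      by (simp add: pdet_eq_det[OF f])
    finally show ?thesis .
  qed
  then show ?thesis by blast
qed

section \<open>Permutations of a finite set and their matrices with root rows deleted\<close>

lemma funpow_in: "t ` C \<subseteq> C \<Longrightarrow> x \<in> C \<Longrightarrow> (t ^^ n) x \<in> C"
  by (induction n) auto

lemma funpow_returns:
  assumes "finite C" "inj_on t C" "t ` C \<subseteq> C" "x \<in> C"
  shows "\<exists>n>0. (t ^^ n) x = x"
proof -
  have bij: "bij_betw t C C"
    using assms endo_inj_surj[of C t] by (simp add: bij_betw_def)
  have "\<not> inj (\<lambda>n. (t ^^ n) x)"
  proof
    assume "inj (\<lambda>n. (t ^^ n) x)"
    then have "infinite (range (\<lambda>n. (t ^^ n) x))" by (simp add: finite_image_iff)
    moreover have "range (\<lambda>n. (t ^^ n) x) \<subseteq> C" using funpow_in[OF assms(3,4)] by auto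
    ultimately show False using assms(1) finite_subset by blast
  qed
  then obtain i j where ij: "i < j" "(t ^^ i) x = (t ^^ j) x"
    unfolding inj_def by (metis linorder_neqE_nat)
  have "(t ^^ i) ((t ^^ (j - i)) x) = (t ^^ i) x"
    using ij by (metis funpow_add le_add_diff_inverse less_imp_le o_apply)
  moreover have "inj_on (t ^^ i) C" using bij_betw_funpow[OF bij] by (auto simp: bij_betw_def)
  ultimately have "(t ^^ (j - i)) x = x"
    using funpow_in[OF assms(3,4)] assms(4) by (auto dest: inj_onD)
  then show ?thesis using ij(1) by (intro exI[of _ "j - i"]) auto
qed

text \<open>Zeroing the rows of the permutation matrix at the roots makes it nilpotent exactly when
  every cycle of \<open>t\<close> meets a root; a cycle without a root gives a vector in the kernel.\<close>
lemma pdet_rooted_permutation: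
  assumes I: "finite I" and inj: "inj_on t I" and t: "t ` I \<subseteq> I"
  shows "pdet (\<lambda>x z. (if x = z then 1 else 0) - (if x \<notin> Rt \<and> t z = x then 1 else 0)) I =
    (if \<forall>x\<in>I. \<exists>n. (t ^^ n) x \<in> Rt then 1 else 0)" (is "pdet ?S I = _")
proof (cases "\<forall>x\<in>I. \<exists>n. (t ^^ n) x \<in> Rt")
  case good: True
  \<comment> \<open>A fixed point of \<open>t\<close> off the roots would put \<open>1 - 1\<close>
    on the diagonal, but its constant orbit would never meet a root.\<close>
  have nofix: "x \<in> Rt" if "x \<in> I" "t x = x" for x
  proof -
    have "(t ^^ n) x = x" for n using that by (induction n) auto
    then show ?thesis using good that by metis
  qed
  \<comment> \<open>In a nonzero term every moved \<open>x\<close> is a nonroot with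
    \<open>t (s x) = x\<close>. So \<open>t\<close> sends moved points to moved points, and the
    \<open>t\<close>-orbit of a moved point would avoid the roots.\<close>
  have zero: "(\<Prod>x\<in>I. ?S x (s x)) = 0" if s: "s permutes I" and ne: "s \<noteq> id" for s
  proof (rule ccontr)
    assume "(\<Prod>x\<in>I. ?S x (s x)) \<noteq> 0"
    then have nz: "?S x (s x) \<noteq> 0" if "x \<in> I" for x using I that by (auto simp: prod_zero_iff)
    have mv: "x \<notin> Rt \<and> t (s x) = x" if "x \<in> I" "s x \<noteq> x" for x
      using nz[OF that(1)] that(2) by (auto split: if_splits)
    have step: "t z \<in> I \<and> s (t z) \<noteq> t z" if z: "z \<in> I" "s z \<noteq> z" for z
    proof -
      obtain x where x: "x \<in> I" "s x = z" using s z(1) permutes_image[OF s] by (metis imageE)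
      then have "s x \<noteq> x" using z by auto
      then show ?thesis using mv[of x] x by metis
    qed
    obtain x where x: "x \<in> I" "s x \<noteq> x" using ne s by (metis eq_id_iff permutes_not_in)
    have "(t ^^ n) x \<in> I \<and> s ((t ^^ n) x) \<noteq> (t ^^ n) x" for n
      by (induction n) (use x step in auto)
    then show False using good mv x by metis
  qed
  have "pdet ?S I = (\<Sum>s\<in>{id}. sign s * (\<Prod>x\<in>I. ?S x (s x)))"
    unfolding pdet_def
    by (rule sum.mono_neutral_right) (use I zero in \<open>auto simp: finite_permutations permutes_id\<close>)
  also have "\<dots> = 1"
    using nofix by (auto simp: sign_id intro!: prod.neutral)
  finally show ?thesis using good by simp
next
  case False
  then obtain p where p: "p \<in> I" "\<And>n. (t ^^ n) p \<notin> Rt" by auto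
  \<comment> \<open>The indicator of the cycle \<open>B\<close> will be the kernel vector:
    \<open>t\<close> permutes \<open>B\<close> and \<open>B\<close> contains no root, so the two
    parts of every row cancel on it.\<close>
  define B where "B = range (\<lambda>n. (t ^^ n) p)"
  have BI: "B \<subseteq> I" using funpow_in[OF t p(1)] by (auto simp: B_def)
  have tB: "t ` B = B"
  proof
    have "t ((t ^^ n) p) \<in> B" for n
      unfolding B_def by (rule range_eqI[of _ _ "Suc n"]) simp
    then show "t ` B \<subseteq> B" by (auto simp: B_def)
    then show "B \<subseteq> t ` B"
      using endo_inj_surj[of B t] I BI inj finite_subset inj_on_subset by blast
  qed
  have "pdet ?S I = 0"
  proof (rule pdet_eq_0_if_kernel[OF I p(1), of "\<lambda>z. if z \<in> B then 1 else 0"])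
    show "(if p \<in> B then 1 else 0) \<noteq> (0::int)"
      unfolding B_def by (metis funpow_0 rangeI zero_neq_one)
    fix x assume x: "x \<in> I"
    have "(\<Sum>j\<in>I. ?S x j * (if j \<in> B then 1 else 0)) = (\<Sum>j\<in>B. ?S x j)"
      using BI I by (auto intro!: sum.mono_neutral_cong_right)
    also have "\<dots> = (\<Sum>j\<in>B. if x = j then 1 else 0) - (\<Sum>j\<in>B. if x \<notin> Rt \<and> t j = x then 1 else 0)"
      by (rule sum_subtractf)
    also have "(\<Sum>j\<in>B. if x \<notin> Rt \<and> t j = x then 1 else 0) =
       (\<Sum>j\<in>t ` B. if x \<notin> Rt \<and> j = x then 1 else (0::int))"
      using inj_on_subset[OF inj BI] by (simp add: sum.reindex)
    also have "\<dots> = (\<Sum>j\<in>B. if x = j then 1 else 0)"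
      unfolding tB using p(2) by (intro sum.cong) (auto simp: B_def)
    finally show "(\<Sum>j\<in>I. ?S x j * (if j \<in> B then 1 else 0)) = 0" by simp
  qed
  then show ?thesis using False by simp
qed

section \<open>Orbits of involutions\<close>

text \<open>The relation behind \<open>orbs\<close>. Its steps are directed; it is symmetric on
  \<open>P\<close> once all maps are involutions of \<open>P\<close>.\<close>

definition reach :: "'p set \<Rightarrow> ('p \<Rightarrow> 'p) set \<Rightarrow> ('p \<times> 'p) set" where
  "reach P fs = {(p, f p) | p f. p \<in> P \<and> f \<in> fs}\<^sup>*"

lemma orbs_eq_reach: "orbs P fs = P // reach P fs"
  by (simp add: orbs_def reach_def)

lemma reach_refl [simp]: "(p, p) \<in> reach P fs"
  by (simp add: reach_def)

lemma reach_step: "(p, q) \<in> reach P fs \<Longrightarrow> q \<in> P \<Longrightarrow> f \<in> fs \<Longrightarrow> (p, f q) \<in> reach P fs"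
  unfolding reach_def by (rule rtrancl_into_rtrancl) auto

lemma reach_trans: "(p, q) \<in> reach P fs \<Longrightarrow> (q, r) \<in> reach P fs \<Longrightarrow> (p, r) \<in> reach P fs"
  unfolding reach_def by (rule rtrancl_trans)

lemma reach_induct [consumes 1, case_names refl step]:
  assumes "(p, q) \<in> reach P fs" "Q p"
    and "\<And>y f. (p, y) \<in> reach P fs \<Longrightarrow> Q y \<Longrightarrow> y \<in> P \<Longrightarrow> f \<in> fs \<Longrightarrow> Q (f y)"
  shows "Q q"
  using assms(1) unfolding reach_def
  by (induction rule: rtrancl_induct) (use assms(2,3) in \<open>auto simp: reach_def\<close>)

lemma reach_in:
  assumes "(p, q) \<in> reach P fs" "p \<in> P" "\<And>f. f \<in> fs \<Longrightarrow> f ` P \<subseteq> P"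
  shows "q \<in> P"
  using assms by (induction rule: reach_induct) auto

lemma reach_sym:
  assumes "(p, q) \<in> reach P fs" "p \<in> P" "\<And>f. f \<in> fs \<Longrightarrow> fpf_inv_on P f"
  shows "(q, p) \<in> reach P fs"
  using assms(1)
proof (induction rule: reach_induct)
  case (step y f)
  have "f y \<in> P" "f (f y) = y" using assms(3)[OF step(3)] step(2) by (auto simp: fpf_inv_on_def)
  then have "(f y, y) \<in> reach P fs" using reach_step[of "f y" "f y" P fs f] step(3) by simp
  then show ?case using step.IH by (rule reach_trans)
qed simp

lemma reach_mono_steps:
  assumes "(p, q) \<in> reach P fs"
    and "\<And>y f. y \<in> P \<Longrightarrow> f \<in> fs \<Longrightarrow> (y, f y) \<in> reach P' gs"
  shows "(p, q) \<in> reach P' gs"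
  using assms(1)
proof (induction rule: reach_induct)
  case (step y f)
  then show ?case using assms(2)[of y f] reach_trans[of p y P' gs "f y"] by simp
qed simp

lemma reach_image_eq:
  assumes "(p, q) \<in> reach P fs" "p \<in> P" "\<And>f. f \<in> fs \<Longrightarrow> fpf_inv_on P f"
  shows "reach P fs `` {p} = reach P fs `` {q}"
proof (intro equalityI subsetI)
  fix x assume "x \<in> reach P fs `` {p}"
  then show "x \<in> reach P fs `` {q}"
    using reach_trans[OF reach_sym[OF assms]] by simp
next
  fix x assume "x \<in> reach P fs `` {q}"
  then show "x \<in> reach P fs `` {p}"
    using reach_trans[OF assms(1)] by simp
qed

lemma fpf_inv_on_image: "fpf_inv_on P f \<Longrightarrow> f ` P \<subseteq> P"
  by (auto simp: fpf_inv_on_def)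

lemma card_orbs_eq_1_iff:
  assumes "P \<noteq> {}" and "\<And>f. f \<in> fs \<Longrightarrow> f ` P \<subseteq> P"
  shows "card (orbs P fs) = 1 \<longleftrightarrow> (\<forall>p\<in>P. \<forall>q\<in>P. (p, q) \<in> reach P fs)"
proof
  assume "card (orbs P fs) = 1"
  then obtain D where D: "orbs P fs = {D}" by (auto simp: card_1_singleton_iff)
  then have "reach P fs `` {p} = D" if "p \<in> P" for p
    using that by (auto simp: orbs_eq_reach quotient_def)
  then show "\<forall>p\<in>P. \<forall>q\<in>P. (p, q) \<in> reach P fs"
    by (metis Image_singleton_iff reach_refl)
next
  assume a: "\<forall>p\<in>P. \<forall>q\<in>P. (p, q) \<in> reach P fs"
  have "reach P fs `` {p} = P" if "p \<in> P" for p
    using a that reach_in[OF _ that assms(2)] by auto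
  then have "orbs P fs = {P}" using assms(1) by (auto simp: orbs_eq_reach quotient_def)
  then show "card (orbs P fs) = 1" by simp
qed

section \<open>Deleting edges: merged free arcs and boundary components\<close>

definition first_in :: "'p set \<Rightarrow> ('p \<Rightarrow> 'p) \<Rightarrow> 'p \<Rightarrow> 'p" where
  "first_in A t x = (t ^^ (LEAST n. (t ^^ n) x \<in> A)) x"

lemma first_in_eq: "x \<in> A \<Longrightarrow> first_in A t x = x"
  by (simp add: first_in_def Least_equality[of _ 0])

lemma first_in_mem: "(t ^^ n) x \<in> A \<Longrightarrow> first_in A t x \<in> A"
  unfolding first_in_def by (rule LeastI)

text \<open>The search starts with iterate 0, so from a point outside \<open>A\<close> the first
  step can be taken beforehand without changing the result.\<close>

lemma first_in_shift:
  assumes "(t ^^ n) x \<in> A" "x \<notin> A"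
  shows "first_in A t (t x) = first_in A t x"
proof -
  have "(LEAST n. (t ^^ n) x \<in> A) = Suc (LEAST n. (t ^^ Suc n) x \<in> A)"
    by (rule Least_Suc[of _ n]) (use assms in auto)
  then show ?thesis
    unfolding first_in_def by (simp add: funpow_swap1)
qed

lemma fpf_inv_comp_perm:
  assumes "fpf_inv_on C f" "fpf_inv_on C g" and t: "\<And>p. t p = f (g p)"
  shows "inj_on t C" "t ` C \<subseteq> C"
proof -
  show "t ` C \<subseteq> C" using assms by (auto simp: fpf_inv_on_def)
  show "inj_on t C"
    by (rule inj_on_inverseI[of _ "\<lambda>x. g (f x)"]) (use assms in \<open>auto simp: fpf_inv_on_def\<close>)
qed

text \<open>Only the values of \<open>g\<close> along the orbit of \<open>x\<close> matter. This
  identifies the orbits that touch no kept edge with vertices of the original graph.\<close>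

lemma reach_image_cong:
  assumes "\<And>y. (x, y) \<in> reach P {f, g} \<Longrightarrow> g y = h y"
  shows "reach P {f, h} `` {x} = reach P {f, g} `` {x}"
proof -
  have "(x, y) \<in> reach P {f, g}" if "(x, y) \<in> reach P {f, h}" for y
    using that
  proof (induction rule: reach_induct)
    case (step y k)
    then show ?case using reach_step[OF step(4,2), of f] reach_step[OF step(4,2), of g] assms[OF step(4)]
      by auto
  qed simp
  moreover have "(x, y) \<in> reach P {f, h}" if "(x, y) \<in> reach P {f, g}" for y
    using that
  proof (induction rule: reach_induct)
    case (step y k)
    then show ?case using reach_step[OF step(4,2), of f] reach_step[OF step(4,2), of h] assms[OF step(1)]
      by auto
  qed simp
  ultimately show ?thesis by auto
qed

text \<open>\<open>A\<close> is the set of corners of the kept edges, and \<open>g\<close> pairs corners along these edges.  A corner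
  outside \<open>A\<close> lies on a merged free arc with two ends in \<open>A\<close>, found by walking in either direction;
  both ends are invariant, up to order, under \<open>sg\<close> and \<open>nu\<close>.\<close>
context
  fixes C A :: "'p set" and sg nu g tau :: "'p \<Rightarrow> 'p"
  assumes C: "finite C" and sg: "fpf_inv_on C sg" and nu: "fpf_inv_on C nu"
    and nu_closed: "\<And>p. p \<in> C \<Longrightarrow> nu p \<in> A \<longleftrightarrow> p \<in> A"
    and g: "fpf_inv_on (C \<inter> A) g"
    and tau: "\<And>p. tau p = sg (nu p)"
begin

abbreviation (input) "sg_sub \<equiv> \<lambda>p. first_in A tau (sg p)"
abbreviation (input) "nu_sub \<equiv> \<lambda>p. if p \<in> A then g p else nu p"

lemmas step_perm = fpf_inv_comp_perm[OF sg nu tau]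

text \<open>\<open>sg p\<close> is \<open>tau (nu p)\<close>, and the \<open>tau\<close>-cycle
  through \<open>nu p\<close> returns to \<open>nu p\<close>, which lies in
  \<open>A\<close>.\<close>

lemma first_in_exists:
  assumes "p \<in> C" "p \<in> A"
  shows "\<exists>n. (tau ^^ n) (sg p) \<in> A"
proof -
  have np: "nu p \<in> C" "nu (nu p) = p" "nu p \<in> A"
    using assms nu nu_closed by (auto simp: fpf_inv_on_def)
  obtain n where n: "n > 0" "(tau ^^ n) (nu p) = nu p"
    using funpow_returns[OF C step_perm np(1)] by blast
  then obtain m where m: "n = Suc m" by (cases n) auto
  have "(tau ^^ n) (nu p) = (tau ^^ m) (sg p)"
    using np(2) unfolding m funpow_Suc_right by (simp add: tau)
  then show ?thesis using n np(3) by auto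
qed

lemma nu_sub_fpf: "fpf_inv_on C nu_sub"
  using g nu nu_closed by (auto simp: fpf_inv_on_def)

lemma sg_sub_in:
  assumes "p \<in> C \<inter> A" shows "sg_sub p \<in> C \<inter> A"
proof -
  have "sg p \<in> C" using assms sg by (auto simp: fpf_inv_on_def)
  then have "sg_sub p \<in> C" using funpow_in[OF step_perm(2)] by (auto simp: first_in_def)
  then show ?thesis using first_in_exists[of p] first_in_mem assms by fastforce
qed

text \<open>The induction has to pass through corners \<open>y\<close> outside \<open>A\<close>, so
  the invariant speaks of both ends of the merged arc through \<open>y\<close>. For \<open>y\<close>
  in \<open>A\<close> the first end is \<open>y\<close> itself.\<close>

lemma reach_sub_forward:
  assumes p: "p \<in> C" "p \<in> A" and y: "(p, y) \<in> reach C {sg, nu_sub}"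
  shows "(\<exists>n. (tau ^^ n) y \<in> A) \<and> (\<exists>n. (tau ^^ n) (sg y) \<in> A) \<and>
    (p, first_in A tau y) \<in> reach (C \<inter> A) {sg_sub, g} \<and> (p, sg_sub y) \<in> reach (C \<inter> A) {sg_sub, g}"
  using y
proof (induction rule: reach_induct)
  case refl
  have "(p, sg_sub p) \<in> reach (C \<inter> A) {sg_sub, g}"
    using reach_step[of p p "C \<inter> A" "{sg_sub, g}" sg_sub] p by simp
  then show ?case using p first_in_exists[OF p] first_in_eq[of p A] by (auto intro: exI[of _ 0])
next
  case (step y f)
  have sgy: "sg (sg y) = y" "sg y \<in> C" "nu (nu y) = y" "nu y \<in> C"
    using step(2) sg nu by (auto simp: fpf_inv_on_def)
  consider "f = sg" | "f \<noteq> sg" "f = nu_sub" using step(3) by auto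
  then show ?case
  proof cases
    case 1
    then show ?thesis using step(4) sgy by simp
  next
    case 2
    show ?thesis
    proof (cases "y \<in> A")
      case True
      have gy: "g y \<in> C" "g y \<in> A" using g True step(2) by (auto simp: fpf_inv_on_def)
      have y: "(p, y) \<in> reach (C \<inter> A) {sg_sub, g}"
        using step(4) first_in_eq[OF True] by simp
      have 1: "(p, g y) \<in> reach (C \<inter> A) {sg_sub, g}"
        by (rule reach_step[OF y]) (use True step(2) in auto)
      have 2: "(p, sg_sub (g y)) \<in> reach (C \<inter> A) {sg_sub, g}"
        by (rule reach_step[OF 1]) (use gy in auto)
      show ?thesis
        using 1 2 gy first_in_exists[OF gy] True \<open>f = nu_sub\<close> first_in_eq[of "g y" A] by (auto intro: exI[of _ 0])
    next
      case False
      have fy: "f y = nu y" using 2 False by simp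
      have nyA: "nu y \<notin> A" using nu_closed step(2) False by simp
      obtain n m where n: "(tau ^^ n) y \<in> A" and m: "(tau ^^ m) (sg y) \<in> A"
        using step(4) by blast
      \<comment> \<open>Crossing a deleted edge shifts both walks by one step: the walk from
        \<open>nu y\<close> continues at \<open>sg y\<close>, and that from \<open>y\<close> at
        \<open>sg (nu y)\<close>. The two ends are exchanged.\<close>
      have t1: "tau (nu y) = sg y" and t2: "tau y = sg (nu y)" using sgy by (auto simp: tau)
      have m': "(tau ^^ Suc m) (nu y) \<in> A" using m t1 by (simp add: funpow_swap1)
      have "n \<noteq> 0" using n False by (metis funpow_0)
      then obtain k where k: "n = Suc k" by (cases n) auto
      have k': "(tau ^^ k) (sg (nu y)) \<in> A" using n unfolding k t2[symmetric] by (simp add: funpow_swap1)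
      have "first_in A tau (nu y) = first_in A tau (sg y)"
        using first_in_shift[OF m' nyA] unfolding t1 by simp
      moreover have "first_in A tau (sg (nu y)) = first_in A tau y"
        using first_in_shift[OF n False] unfolding t2 by simp
      ultimately show ?thesis using step(4) m' k' unfolding fy by metis
    qed
  qed
qed

text \<open>The walk that defines \<open>sg_sub\<close> alternates \<open>nu\<close> and
  \<open>sg\<close>; before its first hit it stays outside \<open>A\<close>, where
  \<open>nu_sub\<close> is \<open>nu\<close>.\<close>

lemma reach_sub_backward:
  assumes "y \<in> C \<inter> A" shows "(y, sg_sub y) \<in> reach C {sg, nu_sub}"
proof -
  let ?l = "LEAST n. (tau ^^ n) (sg y) \<in> A"
  have y: "y \<in> C" "sg y \<in> C" using assms sg by (auto simp: fpf_inv_on_def)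
  have "k \<le> ?l \<Longrightarrow> (y, (tau ^^ k) (sg y)) \<in> reach C {sg, nu_sub}" for k
  proof (induction k)
    case 0
    then show ?case using reach_step[of y y C "{sg, nu_sub}" sg] y by simp
  next
    case (Suc k)
    let ?x = "(tau ^^ k) (sg y)"
    have x: "?x \<in> C" "nu ?x \<in> C" using funpow_in[OF step_perm(2) y(2)] nu by (auto simp: fpf_inv_on_def)
    have "?x \<notin> A" using Suc(2) not_less_Least[of k] by (simp add: Suc_le_eq)
    then have "(y, nu ?x) \<in> reach C {sg, nu_sub}"
      using reach_step[of y ?x C "{sg, nu_sub}" nu_sub] Suc x by simp
    then show ?case using reach_step[of y "nu ?x" C "{sg, nu_sub}" sg] x by (simp add: tau[of ?x])
  qed
  then show ?thesis by (simp add: first_in_def)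
qed

lemma reach_sub_iff:
  assumes p: "p \<in> C \<inter> A" and q: "q \<in> C \<inter> A"
  shows "(p, q) \<in> reach C {sg, nu_sub} \<longleftrightarrow> (p, q) \<in> reach (C \<inter> A) {sg_sub, g}"
proof
  assume "(p, q) \<in> reach C {sg, nu_sub}"
  then show "(p, q) \<in> reach (C \<inter> A) {sg_sub, g}"
    using reach_sub_forward[of p q] p q first_in_eq[of q A] by simp
next
  assume "(p, q) \<in> reach (C \<inter> A) {sg_sub, g}"
  then show "(p, q) \<in> reach C {sg, nu_sub}"
  proof (rule reach_mono_steps)
    fix y f assume yf: "y \<in> C \<inter> A" "f \<in> {sg_sub, g}"
    have "(y, g y) \<in> reach C {sg, nu_sub}"
      using reach_step[of y y C "{sg, nu_sub}" nu_sub] yf by simp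
    then show "(y, f y) \<in> reach C {sg, nu_sub}" using yf reach_sub_backward by auto
  qed
qed

text \<open>Orbits that meet \<open>A\<close> correspond, by intersection with \<open>A\<close>, to
  the orbits of the smaller graph. Orbits that miss \<open>A\<close> are orbits of \<open>sg\<close>
  and \<open>nu\<close>: vertices that lose all their edges.\<close>

lemma card_orbs_sub:
  "card (orbs C {sg, nu_sub}) =
     card (orbs (C \<inter> A) {sg_sub, g}) + card {D \<in> orbs C {sg, nu}. \<forall>p\<in>D. p \<notin> A}"
proof -
  let ?R = "reach C {sg, nu_sub}" and ?R' = "reach (C \<inter> A) {sg_sub, g}"
  let ?U = "{D \<in> orbs C {sg, nu_sub}. D \<inter> A \<noteq> {}}" and ?Z = "{D \<in> orbs C {sg, nu_sub}. D \<inter> A = {}}"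
  have fin: "finite (orbs C {sg, nu_sub})"
    unfolding orbs_eq_reach quotient_def using C by simp
  have fpf: "\<And>f. f \<in> {sg, nu_sub} \<Longrightarrow> fpf_inv_on C f" using sg nu_sub_fpf by auto
  have im: "\<And>f. f \<in> {sg, nu_sub} \<Longrightarrow> f ` C \<subseteq> C" using fpf fpf_inv_on_image by blast
  have im': "\<And>f. f \<in> {sg_sub, g} \<Longrightarrow> f ` (C \<inter> A) \<subseteq> C \<inter> A"
    using sg_sub_in fpf_inv_on_image[OF g] by auto
  have Z: "?Z = {D \<in> orbs C {sg, nu}. \<forall>p\<in>D. p \<notin> A}"
  proof -
    have 1: "reach C {sg, nu} `` {x} = ?R `` {x}" if "?R `` {x} \<inter> A = {}" for x
      by (rule reach_image_cong) (use that in auto)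
    have 2: "?R `` {x} = reach C {sg, nu} `` {x}" if "reach C {sg, nu} `` {x} \<inter> A = {}" for x
      by (rule reach_image_cong) (use that in auto)
    show ?thesis
    proof (intro equalityI subsetI)
      fix D assume "D \<in> ?Z"
      then obtain x where "x \<in> C" "D = ?R `` {x}" "?R `` {x} \<inter> A = {}"
        by (auto simp: orbs_eq_reach quotient_def)
      then show "D \<in> {D \<in> orbs C {sg, nu}. \<forall>p\<in>D. p \<notin> A}"
        using 1[of x] by (auto simp: orbs_eq_reach quotient_def)
    next
      fix D assume "D \<in> {D \<in> orbs C {sg, nu}. \<forall>p\<in>D. p \<notin> A}"
      then obtain x where "x \<in> C" "D = reach C {sg, nu} `` {x}" "reach C {sg, nu} `` {x} \<inter> A = {}"
        by (auto simp: orbs_eq_reach quotient_def)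
      then show "D \<in> ?Z"
        using 2[of x] by (auto simp: orbs_eq_reach quotient_def)
    qed
  qed
  have cut: "?R `` {x} \<inter> A = ?R' `` {x}" if x: "x \<in> C \<inter> A" for x
    using reach_in[OF _ _ im, of x] reach_in[OF _ x im'] reach_sub_iff[OF x] x by blast
  have canon: "\<exists>x\<in>C \<inter> A. D = ?R `` {x}" if D: "D \<in> ?U" for D
  proof -
    obtain x y where xy: "x \<in> C" "D = ?R `` {x}" "y \<in> D" "y \<in> A"
      using D by (auto simp: orbs_eq_reach quotient_def)
    have "y \<in> C" using reach_in[OF _ xy(1) im] xy by auto
    moreover have "?R `` {x} = ?R `` {y}"
      by (rule reach_image_eq[OF _ xy(1) fpf]) (use xy in auto)
    ultimately show ?thesis using xy by auto
  qed
  have "bij_betw (\<lambda>D. D \<inter> A) ?U (orbs (C \<inter> A) {sg_sub, g})"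
  proof (rule bij_betw_imageI)
    show "inj_on (\<lambda>D. D \<inter> A) ?U"
    proof (rule inj_onI)
      fix D D' assume D: "D \<in> ?U" "D' \<in> ?U" "D \<inter> A = D' \<inter> A"
      obtain x x' where x: "x \<in> C \<inter> A" "D = ?R `` {x}" "x' \<in> C \<inter> A" "D' = ?R `` {x'}"
        using canon D(1,2) by meson
      have "x' \<in> D' \<inter> A" using x(3,4) by simp
      then have "x' \<in> D" using D(3) by blast
      then have "(x, x') \<in> ?R" using x by auto
      then have "?R `` {x} = ?R `` {x'}" by (rule reach_image_eq) (use x(1) fpf in auto)
      then show "D = D'" using x(2,4) by simp
    qed
    show "(\<lambda>D. D \<inter> A) ` ?U = orbs (C \<inter> A) {sg_sub, g}"
    proof (intro equalityI subsetI)
      fix D assume "D \<in> (\<lambda>D. D \<inter> A) ` ?U"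
      then obtain x where "x \<in> C \<inter> A" "D = ?R `` {x} \<inter> A" using canon by (metis (no_types, lifting) imageE)
      then show "D \<in> orbs (C \<inter> A) {sg_sub, g}"
        using cut by (auto simp: orbs_eq_reach quotient_def)
    next
      fix D assume "D \<in> orbs (C \<inter> A) {sg_sub, g}"
      then obtain x where x: "x \<in> C \<inter> A" "D = ?R' `` {x}"
        by (auto simp: orbs_eq_reach quotient_def)
      have "x \<in> ?R `` {x} \<inter> A" using x(1) by simp
      moreover have "?R `` {x} \<in> orbs C {sg, nu_sub}"
        using x(1) by (auto simp: orbs_eq_reach quotient_def)
      ultimately have "?R `` {x} \<in> ?U" by blast
      then show "D \<in> (\<lambda>D. D \<inter> A) ` ?U" using cut x by (metis (no_types, lifting) image_eqI)
    qed
  qed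
  then have "card ?U = card (orbs (C \<inter> A) {sg_sub, g})" by (rule bij_betw_same_card)
  moreover have "card (orbs C {sg, nu_sub}) = card ?U + card ?Z"
    using fin by (subst card_Un_disjoint[symmetric]) (auto intro: arg_cong[where f = card])
  ultimately show ?thesis using Z by simp
qed

end

section \<open>Quasi-trees as orbits\<close>

lemma reach_cong:
  assumes "\<And>p. p \<in> P \<Longrightarrow> f p = g p"
  shows "reach P {h, f} = reach P {h, g}"
proof -
  have *: "reach P {h, f} \<subseteq> reach P {h, g}" if "\<And>p. p \<in> P \<Longrightarrow> f p = g p" for f g
  proof (rule subrelI, erule reach_mono_steps)
    fix y k assume "y \<in> P" "k \<in> {h, f}"
    then show "(y, k y) \<in> reach P {h, g}"
      using that[of y] reach_step[of y y P "{h, g}" h] reach_step[of y y P "{h, g}" g] by auto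
  qed
  show ?thesis using *[of f g] *[of g f] assms by auto
qed

lemma reach_closed_subset:
  assumes "C \<subseteq> P" "p \<in> C" "\<And>f. f \<in> fs \<Longrightarrow> f ` C \<subseteq> C"
  shows "(p, q) \<in> reach P fs \<longleftrightarrow> (p, q) \<in> reach C fs"
proof
  assume "(p, q) \<in> reach P fs"
  then have "(p, q) \<in> reach C fs \<and> q \<in> C"
  proof (induction rule: reach_induct)
    case (step y f)
    then show ?case using reach_step[of p y C fs f] assms(3)[of f] by auto
  qed (use assms in auto)
  then show "(p, q) \<in> reach C fs" by simp
next
  assume "(p, q) \<in> reach C fs"
  then show "(p, q) \<in> reach P fs"
  proof (rule reach_mono_steps)
    fix y f assume "y \<in> C" "f \<in> fs"
    then show "(y, f y) \<in> reach P fs" using reach_step[OF reach_refl, of y P f fs] assms(1) by auto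
  qed
qed

text \<open>This is \<open>nu\<close> of the partial dual \<open>pdual G X\<close>, so the boundary
  components of \<open>(V, X)\<close> become its vertices. Unlike \<open>sub_rg\<close> it keeps all
  corners, which lets different \<open>X\<close> be compared on one point set.\<close>

definition nu_on :: "('p, 'e) rgraph \<Rightarrow> 'e set \<Rightarrow> 'p \<Rightarrow> 'p" where
  "nu_on G X p = (if edg G p \<in> X then ep G p else nu G p)"

lemma rgraph_wfD:
  assumes "rgraph_wf G"
  shows "finite (pts G)" "fpf_inv_on (pts G) (sg G)" "fpf_inv_on (pts G) (nu G)"
    "fpf_inv_on (pts G) (ep G)"
    "\<And>p. p \<in> pts G \<Longrightarrow> edg G (nu G p) = edg G p"
    "\<And>p. p \<in> pts G \<Longrightarrow> edg G (ep G p) = edg G p"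
    "\<And>p. p \<in> pts G \<Longrightarrow> nu G (ep G p) = ep G (nu G p)"
    "\<And>p. p \<in> pts G \<Longrightarrow> nu G p \<noteq> ep G p"
    "\<And>p. p \<in> pts G \<Longrightarrow> card {q \<in> pts G. edg G q = edg G p} = 4"
  using assms by (auto simp: rgraph_wf_def)

lemma nu_on_fpf: "rgraph_wf G \<Longrightarrow> fpf_inv_on (pts G) (nu_on G X)"
  by (auto simp: fpf_inv_on_def nu_on_def rgraph_wf_def)

text \<open>The four listed corners are distinct, and an edge has four corners by
  well-formedness.\<close>

lemma edge_points:
  assumes wf: "rgraph_wf G" and p: "p \<in> pts G"
  shows "{q \<in> pts G. edg G q = edg G p} = {p, nu G p, ep G p, nu G (ep G p)}"
    and "distinct [p, nu G p, ep G p, nu G (ep G p)]"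
proof -
  note w = rgraph_wfD[OF wf]
  have np: "nu G p \<in> pts G" "ep G p \<in> pts G" "nu G (ep G p) \<in> pts G"
    "nu G (nu G p) = p" "ep G (ep G p) = p" "nu G p \<noteq> p" "ep G p \<noteq> p"
    "nu G (ep G p) \<noteq> ep G p" "nu G (nu G (ep G p)) = ep G p"
    using w(3,4) p by (auto simp: fpf_inv_on_def)
  show d: "distinct [p, nu G p, ep G p, nu G (ep G p)]"
    using np w(8)[OF p] by (auto; metis)
  have "card {p, nu G p, ep G p, nu G (ep G p)} = 4"
    using distinct_card[OF d] by simp
  moreover have "{p, nu G p, ep G p, nu G (ep G p)} \<subseteq> {q \<in> pts G. edg G q = edg G p}"
    using np p w(5,6) by auto
  ultimately show "{q \<in> pts G. edg G q = edg G p} = {p, nu G p, ep G p, nu G (ep G p)}"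
    using w(1) w(9)[OF p] by (intro card_subset_eq[symmetric]) auto
qed

lemma comps_props:
  assumes wf: "rgraph_wf G" and C: "C \<in> comps G"
  shows "C \<subseteq> pts G" "C \<noteq> {}" "sg G ` C \<subseteq> C" "nu G ` C \<subseteq> C" "ep G ` C \<subseteq> C"
    "\<And>p q. p \<in> C \<Longrightarrow> (p, q) \<in> reach (pts G) {sg G, nu G, ep G} \<longleftrightarrow> q \<in> C"
proof -
  note w = rgraph_wfD[OF wf]
  let ?R = "reach (pts G) {sg G, nu G, ep G}"
  have fpf: "\<And>f. f \<in> {sg G, nu G, ep G} \<Longrightarrow> fpf_inv_on (pts G) f" using w by auto
  obtain x where x: "x \<in> pts G" "C = ?R `` {x}"
    using C by (auto simp: comps_def orbs_eq_reach quotient_def)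
  show "C \<noteq> {}" using x by (metis Image_singleton_iff emptyE reach_refl)
  show sub: "C \<subseteq> pts G"
    using x reach_in[OF _ x(1), of _ "{sg G, nu G, ep G}"] fpf fpf_inv_on_image by blast
  have cl: "f y \<in> C" if "y \<in> C" "f \<in> {sg G, nu G, ep G}" for f y
    using that x sub reach_step[of x y "pts G" "{sg G, nu G, ep G}" f] by auto
  show "sg G ` C \<subseteq> C" "nu G ` C \<subseteq> C" "ep G ` C \<subseteq> C"
    using cl by auto
  fix p q assume p: "p \<in> C"
  have "?R `` {x} = ?R `` {p}"
    by (rule reach_image_eq) (use p x fpf in auto)
  then show "(p, q) \<in> ?R \<longleftrightarrow> q \<in> C" using x by auto
qed

lemma comps_cover:
  assumes "p \<in> pts G"
  shows "\<exists>C\<in>comps G. p \<in> C"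
proof -
  let ?R = "reach (pts G) {sg G, nu G, ep G}"
  have "?R `` {p} \<in> comps G" "p \<in> ?R `` {p}"
    using assms by (auto simp: comps_def orbs_eq_reach quotient_def)
  then show ?thesis by blast
qed

lemma fpf_inv_on_subset: "fpf_inv_on P f \<Longrightarrow> C \<subseteq> P \<Longrightarrow> f ` C \<subseteq> C \<Longrightarrow> fpf_inv_on C f"
  by (auto simp: fpf_inv_on_def)

lemma restrict_rg_wf:
  assumes wf: "rgraph_wf G" and C: "C \<in> comps G"
  shows "rgraph_wf (restrict_rg G C)"
proof -
  note c = comps_props[OF wf C]
  note w = rgraph_wfD[OF wf]
  have "card {q \<in> C. edg G q = edg G p} = 4" if p: "p \<in> C" for p
  proof -
    have "p \<in> pts G" using p c(1) by auto
    note e = edge_points[OF wf this] w(9)[OF this]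
    have "{q \<in> C. edg G q = edg G p} = {q \<in> pts G. edg G q = edg G p}"
      using c(1,3,4,5) p unfolding e(1) using e(1) by blast
    then show ?thesis using e by simp
  qed
  moreover have "fpf_inv_on C (sg G)" "fpf_inv_on C (nu G)" "fpf_inv_on C (ep G)"
    using fpf_inv_on_subset[OF w(2) c(1,3)] fpf_inv_on_subset[OF w(3) c(1,4)]
      fpf_inv_on_subset[OF w(4) c(1,5)] by simp_all
  moreover have "finite C" using c(1) w(1) finite_subset by blast
  ultimately show ?thesis
    using w(5-8) subsetD[OF c(1)] unfolding rgraph_wf_def restrict_rg_def by simp
qed

text \<open>\<open>card_orbs_sub\<close> is applied with the corners of \<open>X\<close> as
  \<open>A\<close> and with \<open>ep\<close> as \<open>g\<close>; its last summand is exactly what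
  \<open>sub_rg\<close> adds to the isolated vertices.\<close>

lemma nbound_sub_rg:
  assumes wf: "rgraph_wf G"
  shows "nbound (sub_rg G X) = card (orbs (pts G) {sg G, nu_on G X}) + rgraph.iso G"
proof -
  note w = rgraph_wfD[OF wf]
  let ?A = "{p. edg G p \<in> X}"
  have gA: "fpf_inv_on (pts G \<inter> ?A) (ep G)"
    using w(4,6) by (auto simp: fpf_inv_on_def)
  have "card (orbs (pts G) {sg G, \<lambda>p. if p \<in> ?A then ep G p else nu G p}) =
     card (orbs (pts G \<inter> ?A) {\<lambda>p. first_in ?A (sg G \<circ> nu G) (sg G p), ep G}) +
     card {D \<in> orbs (pts G) {sg G, nu G}. \<forall>p\<in>D. p \<notin> ?A}"
    by (rule card_orbs_sub) (use w gA in auto)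
  moreover have "(\<lambda>p. if p \<in> ?A then ep G p else nu G p) = nu_on G X"
    by (auto simp: nu_on_def)
  moreover have "pts G \<inter> ?A = {p \<in> pts G. edg G p \<in> X}" by auto
  ultimately show ?thesis
    by (simp add: nbound_def sub_rg_def Let_def first_in_def)
qed

text \<open>A component is closed under all three involutions, so boundary orbits may be computed in
  \<open>G\<close> instead. One orbit per component means that the two reachability relations
  agree.\<close>

lemma qtree_iff:
  assumes wf: "rgraph_wf G"
  shows "qtree G X \<longleftrightarrow> X \<subseteq> E G \<and>
    (\<forall>p\<in>pts G. \<forall>q\<in>pts G. (p, q) \<in> reach (pts G) {sg G, nu G, ep G} \<longrightarrow>
       (p, q) \<in> reach (pts G) {sg G, nu_on G X})"
proof -
  let ?R = "reach (pts G) {sg G, nu_on G X}"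
  have "qtree_conn (restrict_rg G C) (X \<inter> E (restrict_rg G C)) \<longleftrightarrow> (\<forall>p\<in>C. \<forall>q\<in>C. (p, q) \<in> ?R)"
    if C: "C \<in> comps G" for C
  proof -
    let ?H = "restrict_rg G C" and ?X = "X \<inter> E (restrict_rg G C)"
    note c = comps_props[OF wf C]
    have cl: "\<And>f. f \<in> {sg G, nu_on G X} \<Longrightarrow> f ` C \<subseteq> C"
      using c(3-5) by (auto simp: nu_on_def image_subset_iff)
    have "nbound (sub_rg ?H ?X) = card (orbs C {sg G, nu_on ?H ?X})"
      using nbound_sub_rg[OF restrict_rg_wf[OF wf C], of ?X] by (simp add: restrict_rg_def)
    \<comment> \<open>Every corner in \<open>C\<close> has its edge in \<open>E ?H\<close>, so
      intersecting \<open>X\<close> with \<open>E ?H\<close> changes nothing on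
      \<open>C\<close>.\<close>
    moreover have "reach C {sg G, nu_on ?H ?X} = reach C {sg G, nu_on G X}"
      by (rule reach_cong) (auto simp: nu_on_def restrict_rg_def E_def)
    ultimately have "nbound (sub_rg ?H ?X) = card (orbs C {sg G, nu_on G X})"
      by (simp add: orbs_eq_reach)
    then have "qtree_conn ?H ?X \<longleftrightarrow> card (orbs C {sg G, nu_on G X}) = 1"
      by (simp add: qtree_conn_def)
    also have "\<dots> \<longleftrightarrow> (\<forall>p\<in>C. \<forall>q\<in>C. (p, q) \<in> reach C {sg G, nu_on G X})"
      by (rule card_orbs_eq_1_iff[OF c(2) cl])
    also have "\<dots> \<longleftrightarrow> (\<forall>p\<in>C. \<forall>q\<in>C. (p, q) \<in> ?R)"
      using reach_closed_subset[OF c(1) _ cl] by blast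
    finally show ?thesis .
  qed
  then have "qtree G X \<longleftrightarrow> X \<subseteq> E G \<and> (\<forall>C\<in>comps G. \<forall>p\<in>C. \<forall>q\<in>C. (p, q) \<in> ?R)"
    by (simp add: qtree_def)
  also have "\<dots> \<longleftrightarrow> X \<subseteq> E G \<and>
    (\<forall>p\<in>pts G. \<forall>q\<in>pts G. (p, q) \<in> reach (pts G) {sg G, nu G, ep G} \<longrightarrow> (p, q) \<in> ?R)"
  proof (intro conj_cong refl iffI ballI impI)
    fix p q assume a: "\<forall>C\<in>comps G. \<forall>p\<in>C. \<forall>q\<in>C. (p, q) \<in> ?R"
      and pq: "p \<in> pts G" "q \<in> pts G" "(p, q) \<in> reach (pts G) {sg G, nu G, ep G}"
    obtain C where C: "C \<in> comps G" "p \<in> C" using comps_cover[OF pq(1)] by auto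
    then show "(p, q) \<in> ?R" using a comps_props(6)[OF wf C] pq(3) by blast
  next
    fix C p q assume a: "\<forall>p\<in>pts G. \<forall>q\<in>pts G. (p, q) \<in> reach (pts G) {sg G, nu G, ep G} \<longrightarrow> (p, q) \<in> ?R"
      and C: "C \<in> comps G" "p \<in> C" "q \<in> C"
    then show "(p, q) \<in> ?R" using comps_props(1)[OF wf C(1)] comps_props(6)[OF wf C(1,2)] by blast
  qed
  finally show ?thesis .
qed

section \<open>Colourings of the corners\<close>

context
  fixes P :: "'p set" and sg nu :: "'p \<Rightarrow> 'p"
  assumes P: "finite P" and sg: "fpf_inv_on P sg" and nu: "fpf_inv_on P nu"
begin

lemma inv_simps:
  assumes "x \<in> P"
  shows "sg x \<in> P" "nu x \<in> P" "sg (sg x) = x" "nu (nu x) = x" "sg x \<noteq> x" "nu x \<noteq> x"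
  using assms sg nu by (auto simp: fpf_inv_on_def)

text \<open>\<open>nu\<close> is a bijection between the two colour classes, and \<open>sg\<close>
  is one between their parts where \<open>sg\<close> changes the colour; the remaining parts
  therefore have equal size.\<close>

lemma card_monochromatic_balanced:
  assumes c: "\<And>p. p \<in> P \<Longrightarrow> c (nu p) \<noteq> c p"
  shows "card {p \<in> P. c (sg p) = c p \<and> c p} = card {p \<in> P. c (sg p) = c p \<and> \<not> c p}"
proof -
  have 1: "card {p \<in> P. c p} = card {p \<in> P. \<not> c p}"
    by (rule bij_betw_same_card[of nu], rule bij_betw_byWitness[of _ nu])
       (use c in \<open>auto simp: inv_simps\<close>)
  have 2: "card {p \<in> P. c p \<and> c (sg p) \<noteq> c p} = card {p \<in> P. \<not> c p \<and> c (sg p) \<noteq> c p}"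
    by (rule bij_betw_same_card[of sg], rule bij_betw_byWitness[of _ sg])
       (auto simp: inv_simps)
  have split: "card {p \<in> P. Q p} = card {p \<in> P. c (sg p) = c p \<and> Q p} + card {p \<in> P. Q p \<and> c (sg p) \<noteq> c p}"
    for Q
    using P by (subst card_Un_disjoint[symmetric]) (auto intro: arg_cong[where f = card])
  show ?thesis using split[of c] split[of "\<lambda>p. \<not> c p"] 1 2 by simp
qed

context
  fixes tau :: "'p \<Rightarrow> 'p"
  assumes tau: "\<And>p. tau p = sg (nu p)"
begin

lemmas tau_perm = fpf_inv_comp_perm[OF sg nu tau]

text \<open>\<open>nu\<close> after \<open>sg\<close> inverts \<open>tau\<close>, and on a finite
  set an inverse step is also a forward power.\<close>

lemma tau_backward:
  assumes "p \<in> P"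
  shows "\<exists>m. nu (sg ((tau ^^ n) p)) = (tau ^^ m) p"
proof -
  have "\<exists>m. (tau ^^ Suc m) p = (tau ^^ n) p"
  proof (cases n)
    case 0
    obtain k where "k > 0" "(tau ^^ k) p = p" using funpow_returns[OF P tau_perm assms] by blast
    then show ?thesis using 0 by (metis Suc_pred funpow_0)
  qed blast
  then obtain m where "(tau ^^ Suc m) p = (tau ^^ n) p" by blast
  then have "(tau ^^ n) p = sg (nu ((tau ^^ m) p))" by (simp add: tau[of "(tau ^^ m) p"])
  then have "nu (sg ((tau ^^ n) p)) = (tau ^^ m) p"
    using funpow_in[OF tau_perm(2) assms, of m] by (simp add: inv_simps)
  then show ?thesis by blast
qed

text \<open>Two involutions generate a dihedral group, whose elements are the rotations, powers of
  \<open>tau\<close>, and the reflections, \<open>sg\<close> after such powers.\<close>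

lemma reach_dihedral:
  assumes p: "p \<in> P" and q: "(p, q) \<in> reach P {sg, nu}"
  shows "\<exists>n. q = (tau ^^ n) p \<or> q = sg ((tau ^^ n) p)"
  using q
proof (induction rule: reach_induct)
  case refl
  show ?case by (metis funpow_0)
next
  case (step y f)
  then obtain n where n: "y = (tau ^^ n) p \<or> y = sg ((tau ^^ n) p)" by blast
  have x: "(tau ^^ n) p \<in> P" by (rule funpow_in[OF tau_perm(2) p])
  have nuy: "nu ((tau ^^ n) p) = sg ((tau ^^ Suc n) p)"
    using x by (simp add: inv_simps tau[of "(tau ^^ n) p"])
  from step(3) n show ?case
    using tau_backward[OF p, of n] nuy inv_simps(3)[OF x] by (auto simp del: funpow.simps)
qed

lemma reach_tau: "p \<in> P \<Longrightarrow> (p, (tau ^^ n) p) \<in> reach P {sg, nu}"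
proof (induction n)
  case (Suc n)
  have x: "(tau ^^ n) p \<in> P" by (rule funpow_in[OF tau_perm(2) Suc(2)])
  have "(p, nu ((tau ^^ n) p)) \<in> reach P {sg, nu}"
    using reach_step[OF Suc(1) x, of nu] Suc(2) by simp
  then show ?case
    using reach_step[of p "nu ((tau ^^ n) p)" P "{sg, nu}" sg] x by (simp add: inv_simps tau[of "(tau ^^ n) p"])
qed simp

text \<open>An equation \<open>sg x = (tau ^^ k) x\<close> yields one for \<open>tau x\<close> with
  \<open>k - 2\<close> in place of \<open>k\<close>; in the end \<open>sg\<close> or
  \<open>nu\<close> would have a fixed point.\<close>

lemma tau_no_reflection: "x \<in> P \<Longrightarrow> sg x \<noteq> (tau ^^ k) x"
proof (induction k arbitrary: x rule: less_induct)
  case (less k)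
  consider "k = 0" | "k = 1" | j where "k = Suc (Suc j)" by (metis One_nat_def not0_implies_Suc)
  then show ?case
  proof cases
    case 1
    then show ?thesis using less(2) by (simp add: inv_simps)
  next
    case 2
    then show ?thesis using less(2) inv_simps(3)[of "nu x"] inv_simps[of x]
      by (metis One_nat_def funpow_0 funpow.simps(2) o_apply tau)
  next
    case (3 j)
    show ?thesis
    proof
      assume eq: "sg x = (tau ^^ k) x"
      let ?z = "(tau ^^ j) (tau x)"
      have tx: "tau x \<in> P" using tau_perm(2) less(2) by auto
      then have z: "?z \<in> P" by (rule funpow_in[OF tau_perm(2)])
      have "(tau ^^ k) x = tau ?z" unfolding 3 by (simp add: funpow_swap1)
      then have "sg x = sg (nu ?z)" using eq by (simp add: tau[of ?z])
      then have "x = nu ?z" using inv_simps(3)[OF less(2)] inv_simps(2,3) z by metis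
      then have "nu x = ?z" using inv_simps(4)[OF z] by simp
      moreover have "sg (tau x) = nu x" using less(2) by (simp add: tau[of x] inv_simps)
      ultimately show False using less(1)[of j "tau x"] 3 tx by simp
    qed
  qed
qed

text \<open>A single orbit consists of two \<open>tau\<close>-cycles, disjoint by
  \<open>tau_no_reflection\<close> and exchanged by \<open>sg\<close> and by \<open>nu\<close>; the
  colour tells which of them a corner is on. For a bouquet this orients the vertex boundary.\<close>

lemma two_colouring:
  assumes p: "p \<in> P" and conn: "\<And>q. q \<in> P \<Longrightarrow> (p, q) \<in> reach P {sg, nu}"
  shows "\<exists>c :: 'p \<Rightarrow> bool. \<forall>q\<in>P. c (sg q) \<noteq> c q \<and> c (nu q) \<noteq> c q"
proof -
  define c where "c q = (\<exists>n. q = (tau ^^ n) p)" for q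
  have in_P: "(tau ^^ n) p \<in> P" for n by (rule funpow_in[OF tau_perm(2) p])
  have excl: "sg ((tau ^^ n) p) \<noteq> (tau ^^ m) p" for n m
  proof
    assume eq: "sg ((tau ^^ n) p) = (tau ^^ m) p"
    then have eq': "sg ((tau ^^ m) p) = (tau ^^ n) p" using inv_simps(3)[OF in_P, of n] by simp
    show False
    proof (cases "n \<le> m")
      case True
      then have "(tau ^^ m) p = (tau ^^ (m - n)) ((tau ^^ n) p)"
        by (metis add.commute funpow_add le_add_diff_inverse o_apply)
      then show False using eq tau_no_reflection[OF in_P] by metis
    next
      case False
      then have "(tau ^^ n) p = (tau ^^ (n - m)) ((tau ^^ m) p)"
        by (metis add.commute funpow_add le_add_diff_inverse nat_le_linear o_apply)
      then show False using eq' tau_no_reflection[OF in_P] by metis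
    qed
  qed
  have "c (sg q) \<noteq> c q \<and> c (nu q) \<noteq> c q" if q: "q \<in> P" for q
  proof (cases "c q")
    case True
    then obtain n where n: "q = (tau ^^ n) p" by (auto simp: c_def)
    have "nu q = sg ((tau ^^ Suc n) p)"
      using q unfolding n by (simp add: inv_simps tau[of "(tau ^^ n) p"])
    then show ?thesis using True excl by (auto simp: c_def n simp del: funpow.simps)
  next
    case False
    then obtain n where n: "q = sg ((tau ^^ n) p)"
      using reach_dihedral[OF p conn[OF q]] by (auto simp: c_def)
    have "sg q = (tau ^^ n) p" using inv_simps(3)[OF in_P, of n] n by simp
    then show ?thesis using False tau_backward[OF p, of n] n by (auto simp: c_def)
  qed
  then show ?thesis by blast
qed

end

end

section \<open>Orientable loops and pseudo-orientability in terms of corner colourings\<close>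

lemma orientable_loop_iff:
  fixes G :: "('p, 'e) rgraph" and c :: "'p \<Rightarrow> bool"
  assumes wf: "rgraph_wf G" and p: "p \<in> pts G"
    and conn: "\<And>q. q \<in> pts G \<Longrightarrow> (p, q) \<in> reach (pts G) {sg G, nu G}"
    and c: "\<And>q. q \<in> pts G \<Longrightarrow> c (sg G q) \<noteq> c q \<and> c (nu G q) \<noteq> c q"
  shows "orientable_loop G (edg G p) \<longleftrightarrow> c (ep G p) \<noteq> c p"
proof -
  note w = rgraph_wfD[OF wf]
  let ?e = "edg G p"
  let ?A = "{q. edg G q \<in> {?e}}"
  define t where "t = sg G \<circ> nu G"
  have t_apply: "t q = sg G (nu G q)" for q by (simp add: t_def)
  let ?sg = "\<lambda>q. first_in ?A t (sg G q)"
  have t: "t ` pts G \<subseteq> pts G" using w(2,3) by (auto simp: fpf_inv_on_def t_apply)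
  have sub: "orientable_loop G ?e \<longleftrightarrow> (\<exists>d :: 'p \<Rightarrow> bool. \<forall>q\<in>pts G. edg G q = ?e \<longrightarrow>
      d (?sg q) \<noteq> d q \<and> d (nu G q) \<noteq> d q \<and> d (ep G q) \<noteq> d q)"
    by (simp add: orientable_loop_def orientable_rg_def sub_rg_def Let_def first_in_def t_def) blast
  note ep4 = edge_points[OF wf p]
  have mem: "nu G p \<in> pts G" "ep G p \<in> pts G" "nu G (ep G p) \<in> pts G" "ep G (ep G p) = p"
      "nu G (nu G p) = p" "ep G (nu G p) = nu G (ep G p)" "ep G (nu G (ep G p)) = nu G p"
    using w(3,4) w(7)[OF p] p by (auto simp: fpf_inv_on_def)
  \<comment> \<open>Each step of the walk crosses two colour-changing maps, so a merged arc changes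
    the colour just as a single free arc does.\<close>
  have cpow: "c ((t ^^ n) x) = c x" if "x \<in> pts G" for n x
  proof (induction n)
    case (Suc n)
    have y: "(t ^^ n) x \<in> pts G" by (rule funpow_in[OF t that])
    then have "nu G ((t ^^ n) x) \<in> pts G" using w(3) by (auto simp: fpf_inv_on_def)
    then show ?case using Suc c[of "(t ^^ n) x"] c[of "nu G ((t ^^ n) x)"] y by (simp add: t_apply[of "(t ^^ n) x"])
  qed simp
  have csg: "c (?sg q) \<noteq> c q" if "q \<in> pts G" for q
  proof -
    have "sg G q \<in> pts G" using w(2) that by (auto simp: fpf_inv_on_def)
    then show ?thesis using cpow[of "sg G q"] c[OF that] by (simp add: first_in_def)
  qed
  show ?thesis
  proof
    \<comment> \<open>If \<open>ep\<close> changes \<open>c\<close> at one corner of the edge, it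
      does so at all four; then \<open>c\<close> itself orients the one-loop subgraph.\<close>
    assume epc: "c (ep G p) \<noteq> c p"
    have "c (?sg q) \<noteq> c q \<and> c (nu G q) \<noteq> c q \<and> c (ep G q) \<noteq> c q"
      if q: "q \<in> pts G" "edg G q = ?e" for q
    proof -
      have "q \<in> {p, nu G p, ep G p, nu G (ep G p)}" using q unfolding ep4(1)[symmetric] by simp
      then have "c (ep G q) \<noteq> c q"
        using epc mem c[OF p] c[OF mem(2)] by auto
      then show ?thesis using csg[OF q(1)] c[OF q(1)] by simp
    qed
    then show "orientable_loop G ?e" unfolding sub by blast
  next
    assume "orientable_loop G ?e"
    then obtain d :: "'p \<Rightarrow> bool" where d: "\<And>q. q \<in> pts G \<Longrightarrow> edg G q = ?e \<Longrightarrow>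
        d (?sg q) \<noteq> d q \<and> d (nu G q) \<noteq> d q \<and> d (ep G q) \<noteq> d q"
      unfolding sub by blast
    show "c (ep G p) \<noteq> c p"
    proof
      \<comment> \<open>The colouring \<open>d\<close> will force the merged arcs to close up on
        \<open>p\<close> and \<open>nu G p\<close> alone, splitting the vertex boundary against
        \<open>conn\<close>.\<close>
      assume eq: "c (ep G p) = c p"
      have g: "fpf_inv_on (pts G \<inter> ?A) (nu G)" using w(3,5) by (auto simp: fpf_inv_on_def)
      have A: "pts G \<inter> ?A = {p, nu G p, ep G p, nu G (ep G p)}" unfolding ep4(1)[symmetric] by auto
      have edges: "edg G (nu G p) = ?e" "edg G (ep G p) = ?e" using w(5,6) p by auto
      have sgA: "?sg q \<in> pts G \<inter> ?A" if "q \<in> pts G \<inter> ?A" for q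
        by (rule sg_sub_in[OF w(1-3) _ g t_apply that]) (use w(5) in simp)
      \<comment> \<open>\<open>c\<close> leaves only \<open>nu G p\<close> and
        \<open>nu G (ep G p)\<close> as candidates, and the latter has the same
        \<open>d\<close>-colour as \<open>p\<close>.\<close>
      have s1: "?sg p = nu G p"
        using sgA[of p] csg[OF p] d[OF p] d[OF mem(2)] c[OF p] c[OF mem(2)] eq p edges
        unfolding A by auto
      have s2: "?sg (nu G p) = p"
        using sgA[of "nu G p"] csg[OF mem(1)] d[OF p] d[OF mem(1)] d[OF mem(2)] c[OF p] c[OF mem(2)] eq mem edges
        unfolding A by auto
      \<comment> \<open>With \<open>nu\<close> also in the role of \<open>g\<close>,
        \<open>reach_sub_iff\<close> compares the vertex boundary of \<open>G\<close> with that of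
        the one-loop subgraph.\<close>
      have "(p, ep G p) \<in> reach (pts G) {sg G, \<lambda>p. if p \<in> ?A then nu G p else nu G p}"
        using conn[OF mem(2)] by simp
      moreover have "(p, ep G p) \<in> reach (pts G) {sg G, \<lambda>p. if p \<in> ?A then nu G p else nu G p} \<longleftrightarrow>
          (p, ep G p) \<in> reach (pts G \<inter> ?A) {?sg, nu G}"
        by (rule reach_sub_iff[OF w(1-3) _ g t_apply]) (use w(5) p mem edges in simp_all)
      ultimately have r: "(p, ep G p) \<in> reach (pts G \<inter> ?A) {?sg, nu G}" by simp
      have "ep G p \<in> {p, nu G p}"
        using r by (induction rule: reach_induct) (use s1 s2 mem in auto)
      then show False using ep4(2) by auto
    qed
  qed
qed

text \<open>The colouring alternates along \<open>f\<close> except at the two pairs through the cut points, one pair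
  on each colour.\<close>
definition twisted_at :: "'p set \<Rightarrow> ('p \<Rightarrow> 'p) \<Rightarrow> ('p \<Rightarrow> bool) \<Rightarrow> 'p \<Rightarrow> 'p \<Rightarrow> bool" where
  "twisted_at P f c a b \<longleftrightarrow> a \<in> P \<and> b \<in> P \<and> c a \<and> c (f a) \<and> \<not> c b \<and> \<not> c (f b) \<and>
     (\<forall>p\<in>P. p \<notin> {a, f a, b, f b} \<longrightarrow> c (f p) \<noteq> c p)"

text \<open>The orientation \<open>c0\<close> of the vertex circle is reversed on one arc.
  Afterwards \<open>sg\<close> keeps the colour exactly where \<open>s\<close> changes, at no more
  than four corners. These are closed under \<open>sg\<close> and balanced between the colours, so
  there are none or one pair of each colour.\<close>

lemma po_bouquet_colouring:
  fixes G :: "('p, 'e) rgraph"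
  assumes wf: "rgraph_wf G" and po: "po_bouquet G" and ne: "pts G \<noteq> {}"
  shows "\<exists>c :: 'p \<Rightarrow> bool. (\<forall>p\<in>pts G. c (nu G p) \<noteq> c p \<and> c (ep G p) \<noteq> c p) \<and>
     ((\<forall>p\<in>pts G. c (sg G p) \<noteq> c p) \<or> (\<exists>a b. twisted_at (pts G) (sg G) c a b))"
proof -
  note w = rgraph_wfD[OF wf]
  have im: "\<And>f. f \<in> {sg G, nu G} \<Longrightarrow> f ` pts G \<subseteq> pts G" using w(2,3) by (auto simp: fpf_inv_on_def)
  have "finite (orbs (pts G) {sg G, nu G})" "orbs (pts G) {sg G, nu G} \<noteq> {}"
    using w(1) ne by (auto simp: orbs_eq_reach quotient_def)
  then have "card (orbs (pts G) {sg G, nu G}) \<noteq> 0" by simp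
  moreover have "nverts G = 1" using po by (simp add: po_bouquet_def)
  ultimately have "card (orbs (pts G) {sg G, nu G}) = 1" by (simp add: nverts_def)
  then have conn: "(p, q) \<in> reach (pts G) {sg G, nu G}" if "p \<in> pts G" "q \<in> pts G" for p q
    using iffD1[OF card_orbs_eq_1_iff[of "pts G" "{sg G, nu G}", OF ne im]] that by simp
  obtain p0 where p0: "p0 \<in> pts G" using ne by auto
  obtain c0 :: "'p \<Rightarrow> bool" where
    c0': "\<forall>q\<in>pts G. c0 (sg G q) \<noteq> c0 q \<and> c0 (nu G q) \<noteq> c0 q"
    using two_colouring[OF w(1-3) refl p0 conn[OF p0]] by (rule exE)
  note c0 = bspec[OF c0']
  have loop: "orientable_loop G (edg G p) \<longleftrightarrow> c0 (ep G p) \<noteq> c0 p" if "p \<in> pts G" for p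
    by (rule orientable_loop_iff[OF wf that conn[OF that] c0])
  obtain s :: "'p \<Rightarrow> bool" where s': "\<forall>p\<in>pts G. s (nu G p) = s p"
    "card {p \<in> pts G. s (sg G p) \<noteq> s p} \<le> 4"
    "\<forall>p\<in>pts G. orientable_loop G (edg G p) \<longrightarrow> s (ep G p) = s p"
    "\<forall>p\<in>pts G. \<not> orientable_loop G (edg G p) \<longrightarrow> s (ep G p) \<noteq> s p"
    using po unfolding po_bouquet_def by (elim conjE exE) (rule that)
  note s = bspec[OF s'(1)] s'(2) mp[OF bspec[OF s'(3)]] mp[OF bspec[OF s'(4)]]
  \<comment> \<open>Reflecting the arc \<open>S\<^sub>2\<close> makes every loop orientable.\<close>
  define c where "c p = (c0 p \<noteq> s p)" for p
  have cnu: "c (nu G p) \<noteq> c p" if "p \<in> pts G" for p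
    using c0[OF that] s(1)[OF that] by (auto simp: c_def)
  have cep: "c (ep G p) \<noteq> c p" if "p \<in> pts G" for p
    using loop[OF that] s(3,4)[OF that] by (auto simp: c_def)
  have csg: "c (sg G p) = c p \<longleftrightarrow> s (sg G p) \<noteq> s p" if "p \<in> pts G" for p
    using c0[OF that] by (auto simp: c_def)
  let ?B = "{p \<in> pts G. c (sg G p) = c p}"
  let ?T = "{p \<in> pts G. c (sg G p) = c p \<and> c p}" and ?F = "{p \<in> pts G. c (sg G p) = c p \<and> \<not> c p}"
  have fin: "finite ?T" "finite ?F" using w(1) by auto
  have "?B = {p \<in> pts G. s (sg G p) \<noteq> s p}" using csg by blast
  moreover have "?B = ?T \<union> ?F" by blast
  ultimately have "card (?T \<union> ?F) \<le> 4" using s(2) by metis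
  then have le4: "card ?T + card ?F \<le> 4"
    using fin by (subst (asm) card_Un_disjoint) auto
  have bal: "card ?T = card ?F" by (rule card_monochromatic_balanced[OF w(1-3), of c, OF cnu])
  have "(\<forall>p\<in>pts G. c (sg G p) \<noteq> c p) \<or> (\<exists>a b. twisted_at (pts G) (sg G) c a b)"
  proof (cases "?T = {}")
    case True
    then have "card ?F = 0" using bal by (metis card.empty)
    then have "?F = {}" using fin(2) by simp
    then show ?thesis using True by blast
  next
    case False
    then have "card ?F \<noteq> 0" using bal fin(1) by (metis card_eq_0_iff)
    then have "?F \<noteq> {}" by (metis card.empty)
    then obtain b where b: "b \<in> ?F" by blast
    obtain a where a: "a \<in> ?T" using False by blast
    have sg: "sg G p \<in> pts G" "sg G (sg G p) = p" "sg G p \<noteq> p" if "p \<in> pts G" for p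
      using w(2) that by (auto simp: fpf_inv_on_def)
    have subT: "{a, sg G a} \<subseteq> ?T" and subF: "{b, sg G b} \<subseteq> ?F"
      using a b sg by auto
    have "card {a, sg G a} = 2" "card {b, sg G b} = 2" using a b sg(3)[of a] sg(3)[of b] by auto
    then have "card ?T = 2" "card ?F = 2"
      using card_mono[OF fin(1) subT] card_mono[OF fin(2) subF] le4 by auto
    then have "{a, sg G a} = ?T" "{b, sg G b} = ?F"
      using card_subset_eq[OF fin(1) subT] card_subset_eq[OF fin(2) subF]
        \<open>card {a, sg G a} = 2\<close> \<open>card {b, sg G b} = 2\<close> by simp_all
    then have "twisted_at (pts G) (sg G) c a b"
      unfolding twisted_at_def by blast
    then show ?thesis by blast
  qed
  then show ?thesis using cnu cep by (intro exI[of _ c]) simp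
qed

lemma pdual_wf:
  assumes wf: "rgraph_wf G"
  shows "rgraph_wf (pdual G X)"
proof -
  note w = rgraph_wfD[OF wf]
  have inv: "nu G p \<in> pts G" "ep G p \<in> pts G" "nu G (nu G p) = p" "ep G (ep G p) = p"
    "nu G p \<noteq> p" "ep G p \<noteq> p" if "p \<in> pts G" for p
    using w(3,4) that by (auto simp: fpf_inv_on_def)
  have "fpf_inv_on (pts G) (\<lambda>p. if edg G p \<in> X then ep G p else nu G p)"
    "fpf_inv_on (pts G) (\<lambda>p. if edg G p \<in> X then nu G p else ep G p)"
    unfolding fpf_inv_on_def by (simp_all add: inv w(5,6))
  then show ?thesis
    using w(1,2) unfolding rgraph_wf_def pdual_def
    by (simp add: w(5-9) w(8)[symmetric])
qed

text \<open>Partial duality keeps \<open>sg\<close> and only exchanges \<open>nu\<close> and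
  \<open>ep\<close>, which the colouring conditions treat alike; so a colouring of the bouquet fits
  the component itself. Colourings of components glue because each component is closed under the
  three maps.\<close>

lemma pseudo_orientable_colouring:
  fixes G :: "('p, 'e) rgraph"
  assumes wf: "rgraph_wf G" and po: "pseudo_orientable G"
  shows "\<exists>c :: 'p \<Rightarrow> bool. (\<forall>p\<in>pts G. c (nu G p) \<noteq> c p \<and> c (ep G p) \<noteq> c p) \<and>
     ((\<forall>p\<in>pts G. c (sg G p) \<noteq> c p) \<or>
      (\<exists>a b. twisted_at (pts G) (sg G) c a b))"
proof -
  let ?R = "reach (pts G) {sg G, nu G, ep G}"
  define flip where "flip D c \<longleftrightarrow> (\<forall>p\<in>D. c (nu G p) \<noteq> c p \<and> c (ep G p) \<noteq> c p)"
    for D and c :: "'p \<Rightarrow> bool"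
  define alt where "alt D c \<longleftrightarrow> (\<forall>p\<in>D. c (sg G p) \<noteq> c p)" for D and c :: "'p \<Rightarrow> bool"
  have or_col: "\<exists>c. flip D c \<and> alt D c" if "orientable_rg (restrict_rg G D)" for D
  proof -
    have "\<exists>c :: 'p \<Rightarrow> bool. \<forall>p\<in>D. c (sg G p) \<noteq> c p \<and> c (nu G p) \<noteq> c p \<and> c (ep G p) \<noteq> c p"
      using that unfolding orientable_rg_def restrict_rg_def by simp
    then obtain c :: "'p \<Rightarrow> bool" where
      "\<forall>p\<in>D. c (sg G p) \<noteq> c p \<and> c (nu G p) \<noteq> c p \<and> c (ep G p) \<noteq> c p"
      by (rule exE)
    then show ?thesis unfolding flip_def alt_def by (intro exI[of _ c]) simp
  qed
  have po_col: "\<exists>c. flip D c \<and> (alt D c \<or> (\<exists>a b. twisted_at D (sg G) c a b))"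
    if D: "D \<in> comps G" and po: "conn_pseudo_orientable (restrict_rg G D)" for D
  proof -
    obtain X where X: "po_bouquet (pdual (restrict_rg G D) X)"
      using po by (auto simp: conn_pseudo_orientable_def)
    have "pts (pdual (restrict_rg G D) X) \<noteq> {}"
      using comps_props(2)[OF wf D] by (simp add: pdual_def restrict_rg_def)
    from po_bouquet_colouring[OF pdual_wf[OF restrict_rg_wf[OF wf D]] X this]
    obtain c :: "'p \<Rightarrow> bool" where c:
      "\<forall>p\<in>pts (pdual (restrict_rg G D) X). c (nu (pdual (restrict_rg G D) X) p) \<noteq> c p \<and>
         c (ep (pdual (restrict_rg G D) X) p) \<noteq> c p"
      "(\<forall>p\<in>pts (pdual (restrict_rg G D) X). c (sg (pdual (restrict_rg G D) X) p) \<noteq> c p) \<or>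
         (\<exists>a b. twisted_at (pts (pdual (restrict_rg G D) X)) (sg (pdual (restrict_rg G D) X)) c a b)"
      by (elim conjE exE) (rule that)
    have "flip D c"
      using c(1) unfolding flip_def by (auto simp: pdual_def restrict_rg_def split: if_splits)
    moreover have "alt D c \<or> (\<exists>a b. twisted_at D (sg G) c a b)"
      using c(2) unfolding alt_def by (simp add: pdual_def restrict_rg_def)
    ultimately show ?thesis by blast
  qed
  have glue: ?thesis
    if C: "\<And>D. D \<in> comps G \<Longrightarrow> D \<noteq> C \<Longrightarrow> \<exists>c. flip D c \<and> alt D c"
      and CC: "C \<in> comps G \<Longrightarrow> \<exists>c. flip C c \<and> (alt C c \<or> (\<exists>a b. twisted_at C (sg G) c a b))" for C
  proof -
    have "\<forall>D. \<exists>c. D \<in> comps G \<longrightarrow> flip D c \<and> (alt D c \<or> D = C \<and> (\<exists>a b. twisted_at D (sg G) c a b))"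
      using C CC by blast
    then obtain f where f: "\<And>D. D \<in> comps G \<Longrightarrow> flip D (f D)"
      "\<And>D. D \<in> comps G \<Longrightarrow> alt D (f D) \<or> D = C \<and> (\<exists>a b. twisted_at D (sg G) (f D) a b)"
      by metis
    define c where "c p = f (?R `` {p}) p" for p
    have cD: "c p = f D p" if "D \<in> comps G" "p \<in> D" for D p
    proof -
      have "?R `` {p} = D" using comps_props(6)[OF wf that] by auto
      then show ?thesis by (simp add: c_def)
    qed
    have cl: "sg G p \<in> D" "nu G p \<in> D" "ep G p \<in> D" if "D \<in> comps G" "p \<in> D" for D p
      using comps_props(3-5)[OF wf that(1)] that(2) by auto
    have 1: "c (nu G p) \<noteq> c p \<and> c (ep G p) \<noteq> c p" if p: "p \<in> pts G" for p
    proof -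
      obtain D where D: "D \<in> comps G" "p \<in> D" using comps_cover[OF p] by blast
      then show ?thesis using f(1)[OF D(1)] cD[OF D(1)] cl[OF D] unfolding flip_def by simp
    qed
    have altD: "c (sg G p) \<noteq> c p" if "D \<in> comps G" "p \<in> D" "alt D (f D)" for D p
      using that cD[OF that(1)] cl[OF that(1,2)] unfolding alt_def by simp
    show ?thesis
    proof (cases "\<exists>a b. C \<in> comps G \<and> twisted_at C (sg G) (f C) a b")
      case False
      have "c (sg G p) \<noteq> c p" if p: "p \<in> pts G" for p
      proof -
        obtain D where D: "D \<in> comps G" "p \<in> D" using comps_cover[OF p] by blast
        then show ?thesis using altD f(2)[OF D(1)] False by metis
      qed
      then show ?thesis using 1 by (intro exI[of _ c]) simp
    next
      case True
      then obtain a b where Cc: "C \<in> comps G" and ab: "twisted_at C (sg G) (f C) a b" by blast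
      have abC: "a \<in> C" "b \<in> C" using ab by (auto simp: twisted_at_def)
      have "c (sg G p) \<noteq> c p" if p: "p \<in> pts G" "p \<notin> {a, sg G a, b, sg G b}" for p
      proof -
        obtain D where D: "D \<in> comps G" "p \<in> D" using comps_cover[OF p(1)] by blast
        show ?thesis
        proof (cases "D = C")
          case True
          then show ?thesis
            using ab D p(2) cD[OF Cc] cl[OF D] unfolding twisted_at_def by simp
        next
          case False
          then show ?thesis using altD[OF D] f(2)[OF D(1)] by blast
        qed
      qed
      moreover have "c a" "c (sg G a)" "\<not> c b" "\<not> c (sg G b)"
        using ab cD[OF Cc] cl[OF Cc] abC unfolding twisted_at_def by simp_all
      moreover have "a \<in> pts G" "b \<in> pts G" using abC comps_props(1)[OF wf Cc] by auto
      ultimately have "twisted_at (pts G) (sg G) c a b" unfolding twisted_at_def by blast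
      then show ?thesis using 1 by (intro exI[of _ c]) blast
    qed
  qed
  from po consider C where "C \<in> comps G" "conn_pseudo_orientable (restrict_rg G C)"
      "\<forall>C'\<in>comps G - {C}. orientable_rg (restrict_rg G C')"
    | "\<forall>C\<in>comps G. orientable_rg (restrict_rg G C)"
    unfolding pseudo_orientable_def by blast
  then show ?thesis
  proof cases
    case 1
    show ?thesis by (rule glue[of C]) (use 1 or_col po_col in blast)+
  next
    case 2
    \<comment> \<open>No component is exceptional here, and \<open>{}\<close> is a dummy. This
      covers the case of an isolated vertex as the pseudo-orientable component.\<close>
    show ?thesis by (rule glue[of "{}"]) (use 2 or_col in blast)+
  qed
qed

section \<open>The determinant of a rooted colouring\<close>

text \<open>Composing with a transposition splits or joins cycles. At the first positive time
  \<open>n\<close> when the \<open>t\<close>-orbit of \<open>a\<close> meets \<open>{a, a'}\<close>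
  the two maps part: one returns to \<open>a\<close>, the other arrives at
  \<open>a'\<close>.\<close>

lemma transposition_separates:
  assumes I: "finite I" "inj_on t I" "t ` I \<subseteq> I" and a: "a \<in> I" "a \<noteq> a'"
    and t': "\<And>x. x \<in> I \<Longrightarrow> t' x = (if t x = a then a' else if t x = a' then a else t x)"
  shows "(\<exists>n. (t ^^ n) a = a') \<longleftrightarrow> \<not> (\<exists>n. (t' ^^ n) a = a')"
proof -
  let ?Q = "\<lambda>n. n > 0 \<and> (t ^^ n) a \<in> {a, a'}"
  define n where "n = (LEAST n. ?Q n)"
  have "\<exists>n. ?Q n" using funpow_returns[OF I a(1)] by auto
  then have Qn: "?Q n" unfolding n_def by (rule LeastI_ex)
  have min: "(t ^^ k) a \<notin> {a, a'}" if "0 < k" "k < n" for k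
    using not_less_Least[of k ?Q] that unfolding n_def by blast
  have in_I: "(t ^^ k) a \<in> I" for k by (rule funpow_in[OF I(3) a(1)])
  have same: "k < n \<Longrightarrow> (t' ^^ k) a = (t ^^ k) a" for k
  proof (induction k)
    case (Suc k)
    then show ?case using t'[OF in_I[of k]] min[of "Suc k"] by auto
  qed simp
  obtain m where m: "n = Suc m" using Qn by (cases n) auto
  have t'n: "(t' ^^ n) a = (if (t ^^ n) a = a then a' else a)"
    using same[of m] t'[OF in_I[of m]] Qn unfolding m by auto
  \<comment> \<open>The orbit that returns at time \<open>n\<close> has period \<open>n\<close>, and
    before \<open>n\<close> it avoids \<open>a'\<close>.\<close>
  have never: "(f ^^ k) a \<noteq> a'" if f: "(f ^^ n) a = a" "\<And>k. k < n \<Longrightarrow> (f ^^ k) a = (t ^^ k) a" for f k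
  proof
    assume "(f ^^ k) a = a'"
    then have "(f ^^ (k mod n)) a = a'" using funpow_mod_eq[OF f(1)] by simp
    moreover have "k mod n < n" using Qn by simp
    ultimately have "(t ^^ (k mod n)) a = a'" "k mod n \<noteq> 0" using f(2) a(2) by (auto intro: Nat.gr0I)
    then show False using min[of "k mod n"] \<open>k mod n < n\<close> by simp
  qed
  show ?thesis
  proof (cases "(t ^^ n) a = a")
    case True
    then show ?thesis using never[of t] t'n by auto
  next
    case False
    then have "(t ^^ n) a = a'" using Qn by auto
    then show ?thesis using never[of t'] t'n same False by auto
  qed
qed

definition rooted :: "'p set \<Rightarrow> 'p set \<Rightarrow> ('p \<Rightarrow> 'p) set \<Rightarrow> bool" where
  "rooted P Rt fs \<longleftrightarrow> (\<forall>p\<in>P. \<exists>r\<in>Rt. (p, r) \<in> reach P fs)"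

context
  fixes P :: "'p set" and sg nu :: "'p \<Rightarrow> 'p" and c :: "'p \<Rightarrow> bool"
  assumes P: "finite P" and sg: "fpf_inv_on P sg" and nu: "fpf_inv_on P nu"
    and c_sg: "\<And>p. p \<in> P \<Longrightarrow> c (sg p) \<noteq> c p" and c_nu: "\<And>p. p \<in> P \<Longrightarrow> c (nu p) \<noteq> c p"
begin

lemma colour_tau:
  assumes "p \<in> P" "c p"
  shows "((\<lambda>x. sg (nu x)) ^^ n) p \<in> P \<and> c (((\<lambda>x. sg (nu x)) ^^ n) p)"
proof (induction n)
  case (Suc n)
  let ?x = "((\<lambda>x. sg (nu x)) ^^ n) p"
  have "nu ?x \<in> P" "sg (nu ?x) \<in> P" using Suc sg nu by (auto simp: fpf_inv_on_def)
  then show ?case using Suc c_nu[of ?x] c_sg[of "nu ?x"] by simp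
qed (use assms in simp)

text \<open>Powers of \<open>tau\<close> keep the colour and a further \<open>sg\<close> changes it,
  so only the first alternative of \<open>reach_dihedral\<close> survives.\<close>

lemma reach_same_colour:
  assumes p: "p \<in> P" "c p" and q: "c q"
  shows "(p, q) \<in> reach P {sg, nu} \<longleftrightarrow> (\<exists>n. ((\<lambda>x. sg (nu x)) ^^ n) p = q)"
proof
  assume "(p, q) \<in> reach P {sg, nu}"
  then obtain n where n: "q = ((\<lambda>x. sg (nu x)) ^^ n) p \<or> q = sg (((\<lambda>x. sg (nu x)) ^^ n) p)"
    using reach_dihedral[OF P sg nu refl p(1)] by blast
  then show "\<exists>n. ((\<lambda>x. sg (nu x)) ^^ n) p = q"
    using q colour_tau[OF p, of n] c_sg by metis
next
  assume "\<exists>n. ((\<lambda>x. sg (nu x)) ^^ n) p = q"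
  then show "(p, q) \<in> reach P {sg, nu}"
    using reach_tau[OF P sg nu refl p(1)] by blast
qed

lemma tau_on_colour:
  "inj_on (\<lambda>x. sg (nu x)) {p \<in> P. c p}" "(\<lambda>x. sg (nu x)) ` {p \<in> P. c p} \<subseteq> {p \<in> P. c p}"
  using inj_on_subset[OF fpf_inv_comp_perm(1)[OF sg nu refl], of "{p \<in> P. c p}"] colour_tau[of _ 1]
  by auto

text \<open>On the coloured corners the cycles of \<open>sg\<close> after \<open>nu\<close> are the
  traces of the orbits. An uncoloured corner is first moved by \<open>nu\<close>, which stays in its
  orbit.\<close>

lemma pdet_rooted:
  assumes Rt: "Rt \<subseteq> {p \<in> P. c p}"
  shows "pdet (\<lambda>x z. (if x = z then 1 else 0) - (if x \<notin> Rt \<and> sg (nu z) = x then 1 else 0)) {p \<in> P. c p} =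
    (if rooted P Rt {sg, nu} then 1 else 0)"
proof -
  have "(\<forall>x\<in>{p \<in> P. c p}. \<exists>n. ((\<lambda>x. sg (nu x)) ^^ n) x \<in> Rt) \<longleftrightarrow> rooted P Rt {sg, nu}"
  proof
    assume a: "\<forall>x\<in>{p \<in> P. c p}. \<exists>n. ((\<lambda>x. sg (nu x)) ^^ n) x \<in> Rt"
    have 1: "\<exists>r\<in>Rt. (p, r) \<in> reach P {sg, nu}" if p: "p \<in> P" "c p" for p
      using a p reach_tau[OF P sg nu refl p(1)] by blast
    have "\<exists>r\<in>Rt. (p, r) \<in> reach P {sg, nu}" if p: "p \<in> P" for p
    proof (cases "c p")
      case False
      have np: "nu p \<in> P" using p nu by (auto simp: fpf_inv_on_def)
      obtain r where r: "r \<in> Rt" "(nu p, r) \<in> reach P {sg, nu}"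
        using 1[OF np] c_nu[OF p] False by blast
      have "(p, nu p) \<in> reach P {sg, nu}" using reach_step[OF reach_refl p, of nu] by simp
      then show ?thesis using r reach_trans by metis
    qed (use 1 p in simp)
    then show "rooted P Rt {sg, nu}" by (simp add: rooted_def)
  next
    assume a: "rooted P Rt {sg, nu}"
    show "\<forall>x\<in>{p \<in> P. c p}. \<exists>n. ((\<lambda>x. sg (nu x)) ^^ n) x \<in> Rt"
    proof
      fix x assume x: "x \<in> {p \<in> P. c p}"
      then obtain r where "r \<in> Rt" "(x, r) \<in> reach P {sg, nu}" using a by (auto simp: rooted_def)
      then show "\<exists>n. ((\<lambda>x. sg (nu x)) ^^ n) x \<in> Rt"
        using reach_same_colour[of x r] x Rt by blast
    qed
  qed
  then show ?thesis
    using pdet_rooted_permutation[OF _ tau_on_colour, of Rt] P by simp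
qed

end

text \<open>Reconnects the two monochromatic pairs so that the colouring alternates everywhere; the two
  possible reconnections are \<open>untwist f a b\<close> and \<open>untwist f a (f b)\<close>.\<close>
definition untwist :: "('p \<Rightarrow> 'p) \<Rightarrow> 'p \<Rightarrow> 'p \<Rightarrow> 'p \<Rightarrow> 'p" where
  "untwist f a b = f(a := b, b := a, f a := f b, f b := f a)"

section \<open>Orbits before and after a reconnection at the cut points\<close>

context
  fixes P :: "'p set" and sg :: "'p \<Rightarrow> 'p" and c :: "'p \<Rightarrow> bool" and a b :: 'p
  assumes sg: "fpf_inv_on P sg" and tw: "twisted_at P sg c a b"
begin

lemma twisted_points:
  "a \<in> P" "b \<in> P" "sg a \<in> P" "sg b \<in> P" "c a" "c (sg a)" "\<not> c b" "\<not> c (sg b)"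
  "sg (sg a) = a" "sg (sg b) = b" "sg a \<noteq> a" "sg b \<noteq> b"
  "a \<noteq> b" "a \<noteq> sg b" "b \<noteq> a" "sg b \<noteq> a" "sg a \<noteq> b" "sg a \<noteq> sg b" "b \<noteq> sg a" "sg b \<noteq> sg a"
  "a \<noteq> sg a" "b \<noteq> sg b"
  using tw sg unfolding twisted_at_def fpf_inv_on_def by (safe; metis)+

lemma twisted_other:
  assumes "p \<in> P" "p \<notin> {a, sg a, b, sg b}"
  shows "c (sg p) \<noteq> c p" "sg p \<notin> {a, sg a, b, sg b}" "sg p \<in> P" "sg (sg p) = p" "sg p \<noteq> p"
proof -
  show "c (sg p) \<noteq> c p" using tw assms unfolding twisted_at_def by simp
  show s: "sg p \<in> P" "sg (sg p) = p" "sg p \<noteq> p" using sg assms by (auto simp: fpf_inv_on_def)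
  show "sg p \<notin> {a, sg a, b, sg b}" using s(2) assms(2) twisted_points(9,10) by auto
qed

lemma untwist_apply:
  "untwist sg a b a = b" "untwist sg a b b = a" "untwist sg a b (sg a) = sg b"
  "untwist sg a b (sg b) = sg a" "p \<notin> {a, sg a, b, sg b} \<Longrightarrow> untwist sg a b p = sg p"
  using twisted_points by (auto simp: untwist_def)

lemma untwist_fpf: "fpf_inv_on P (untwist sg a b)"
  unfolding fpf_inv_on_def
proof
  fix p assume p: "p \<in> P"
  show "untwist sg a b p \<in> P \<and> untwist sg a b (untwist sg a b p) = p \<and> untwist sg a b p \<noteq> p"
  proof (cases "p \<in> {a, sg a, b, sg b}")
    case True
    then show ?thesis using twisted_points by (auto simp: untwist_apply)
  next
    case False
    then show ?thesis using twisted_other[OF p False] by (simp add: untwist_apply(5))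
  qed
qed

lemma untwist_flips: "p \<in> P \<Longrightarrow> c (untwist sg a b p) \<noteq> c p"
proof (cases "p \<in> {a, sg a, b, sg b}")
  case True
  then show ?thesis using twisted_points by (auto simp: untwist_apply)
next
  case False
  then show "p \<in> P \<Longrightarrow> ?thesis" using twisted_other(1) by (simp add: untwist_apply(5))
qed

lemma twisted_at_sym: "twisted_at P sg c a (sg b)"
  using tw twisted_points unfolding twisted_at_def by auto

context
  fixes nu :: "'p \<Rightarrow> 'p"
  assumes nu: "fpf_inv_on P nu"
begin

text \<open>The reconnection links \<open>a\<close> to \<open>b\<close> and \<open>sg a\<close> to
  \<open>sg b\<close>, so a path from \<open>a\<close> to \<open>sg a\<close> also yields one from
  \<open>b\<close> to \<open>sg b\<close>. Both removed pairs can thus be bypassed.\<close>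

lemma reach_untwist:
  assumes aa: "(a, sg a) \<in> reach P {untwist sg a b, nu}" and pq: "(p, q) \<in> reach P {sg, nu}"
  shows "(p, q) \<in> reach P {untwist sg a b, nu}"
  using pq
proof (rule reach_mono_steps)
  let ?R = "reach P {untwist sg a b, nu}"
  fix y f assume y: "y \<in> P" "f \<in> {sg, nu}"
  have fpf: "\<And>f. f \<in> {untwist sg a b, nu} \<Longrightarrow> fpf_inv_on P f" using untwist_fpf nu by auto
  have s: "(x, untwist sg a b x) \<in> ?R" "(x, nu x) \<in> ?R" if "x \<in> P" for x
    using reach_step[OF reach_refl that] by auto
  note t = twisted_points
  have aa': "(sg a, a) \<in> ?R" by (rule reach_sym[OF aa t(1) fpf])
  have "(b, a) \<in> ?R" "(sg a, sg b) \<in> ?R" using s(1)[OF t(2)] s(1)[OF t(3)] by (simp_all add: untwist_apply)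
  then have bb: "(b, sg b) \<in> ?R" using aa reach_trans by metis
  have bb': "(sg b, b) \<in> ?R" by (rule reach_sym[OF bb t(2) fpf])
  show "(y, f y) \<in> ?R"
  proof (cases "f = nu")
    case True
    then show ?thesis using s(2)[OF y(1)] by simp
  next
    case False
    then have "f = sg" using y by simp
    then show ?thesis
      using aa aa' bb bb' s(1)[OF y(1)] untwist_apply(5)[of y] t(9,10)
      by (cases "y \<in> {a, sg a, b, sg b}") auto
  qed
qed

context
  assumes P: "finite P" and c_nu: "\<And>p. p \<in> P \<Longrightarrow> c (nu p) \<noteq> c p"
begin

text \<open>Balance applied to the orbit of \<open>a\<close> alone: it contains the coloured
  monochromatic corner \<open>a\<close>, hence also an uncoloured one, which must be
  \<open>b\<close> or \<open>sg b\<close>.\<close>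

lemma reach_a_b: "(a, b) \<in> reach P {sg, nu}"
proof -
  let ?B = "reach P {sg, nu} `` {a}"
  have im: "\<And>f. f \<in> {sg, nu} \<Longrightarrow> f ` P \<subseteq> P" using sg nu by (auto simp: fpf_inv_on_def)
  have BP: "?B \<subseteq> P" using reach_in[OF _ twisted_points(1), of _ "{sg, nu}"] im by blast
  have cl: "sg y \<in> ?B" "nu y \<in> ?B" if "y \<in> ?B" for y
    using reach_step[of a y P "{sg, nu}" sg] reach_step[of a y P "{sg, nu}" nu] that BP by auto
  have fpf: "fpf_inv_on ?B sg" "fpf_inv_on ?B nu"
    using fpf_inv_on_subset[OF sg BP] fpf_inv_on_subset[OF nu BP] cl by (auto simp del: Image_singleton_iff)
  have "card {p \<in> ?B. c (sg p) = c p \<and> c p} = card {p \<in> ?B. c (sg p) = c p \<and> \<not> c p}"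
    by (rule card_monochromatic_balanced[OF finite_subset[OF BP P] fpf]) (use c_nu BP in blast)
  moreover have "a \<in> {p \<in> ?B. c (sg p) = c p \<and> c p}" using twisted_points by simp
  moreover have "finite {p \<in> ?B. c (sg p) = c p \<and> c p}"
    by (rule finite_subset[OF _ P]) (use BP in blast)
  ultimately have "card {p \<in> ?B. c (sg p) = c p \<and> \<not> c p} \<noteq> 0" by (metis card_eq_0_iff emptyE)
  then have "{p \<in> ?B. c (sg p) = c p \<and> \<not> c p} \<noteq> {}" by (metis card.empty)
  then obtain p where p: "p \<in> ?B" "c (sg p) = c p" "\<not> c p" by blast
  then have "p \<in> {a, sg a, b, sg b}" using twisted_other(1)[of p] BP by blast
  then have "p = b \<or> p = sg b" using p(3) twisted_points(5,6) by auto
  then show ?thesis using p(1) cl(1)[OF p(1)] twisted_points(10) by auto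
qed

text \<open>By \<open>reach_a_b\<close> all four reconnected corners lie in one orbit, so the new
  links never join different orbits.\<close>

lemma untwist_reach:
  assumes "(p, q) \<in> reach P {untwist sg a b, nu}"
  shows "(p, q) \<in> reach P {sg, nu}"
  using assms
proof (rule reach_mono_steps)
  let ?R = "reach P {sg, nu}"
  fix y f assume y: "y \<in> P" "f \<in> {untwist sg a b, nu}"
  have fpf: "\<And>f. f \<in> {sg, nu} \<Longrightarrow> fpf_inv_on P f" using sg nu by auto
  have s: "(x, sg x) \<in> ?R" "(x, nu x) \<in> ?R" if "x \<in> P" for x
    using reach_step[OF reach_refl that] by auto
  note t = twisted_points
  have ba: "(b, a) \<in> ?R" by (rule reach_sym[OF reach_a_b t(1) fpf])
  have 1: "(sg a, sg b) \<in> ?R"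
    using reach_trans[OF s(1)[OF t(3)], unfolded t(9)] reach_trans[OF reach_a_b s(1)[OF t(2)]] by blast
  have 2: "(sg b, sg a) \<in> ?R" by (rule reach_sym[OF 1 t(3) fpf])
  show "(y, f y) \<in> ?R"
  proof (cases "f = nu")
    case True
    then show ?thesis using s(2)[OF y(1)] by simp
  next
    case False
    then have "f = untwist sg a b" using y by simp
    then show ?thesis
      using 1 2 ba reach_a_b s(1)[OF y(1)] untwist_apply
      by (cases "y \<in> {a, sg a, b, sg b}") auto
  qed
qed

end

end

end

text \<open>Every component has coloured corners because \<open>nu\<close> changes the colour. The
  parameter \<open>r0\<close> prescribes the root of one component; the twisted case needs
  \<open>sg a\<close> as a root.\<close>

lemma component_roots:
  fixes G :: "('p, 'e) rgraph"
  assumes wf: "rgraph_wf G" and c: "\<And>p. p \<in> pts G \<Longrightarrow> c (nu G p) \<noteq> c p"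
  shows "\<exists>Rt \<subseteq> {p \<in> pts G. c p}. (r0 \<in> pts G \<and> c r0 \<longrightarrow> r0 \<in> Rt) \<and>
     (\<forall>p\<in>pts G. \<exists>!r. r \<in> Rt \<and> (p, r) \<in> reach (pts G) {sg G, nu G, ep G})"
proof -
  let ?R = "reach (pts G) {sg G, nu G, ep G}"
  define f where "f D = (if r0 \<in> D \<and> c r0 then r0 else SOME p. p \<in> D \<and> c p)" for D
  have f: "f D \<in> D \<and> c (f D)" if D: "D \<in> comps G" for D
  proof -
    obtain p where p: "p \<in> D" using comps_props(2)[OF wf D] by blast
    have "nu G p \<in> D" using comps_props(4)[OF wf D] p by auto
    moreover have "c (nu G p) \<noteq> c p" using c comps_props(1)[OF wf D] p by auto
    ultimately have "\<exists>p. p \<in> D \<and> c p" using p by metis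
    then have "(SOME p. p \<in> D \<and> c p) \<in> D \<and> c (SOME p. p \<in> D \<and> c p)" by (rule someI_ex)
    then show ?thesis by (simp add: f_def)
  qed
  have D_eq: "?R `` {p} = D" if "D \<in> comps G" "p \<in> D" for D p
    using comps_props(6)[OF wf that] by auto
  have "f ` comps G \<subseteq> {p \<in> pts G. c p}"
    using f comps_props(1)[OF wf] by blast
  moreover have "r0 \<in> f ` comps G" if r0: "r0 \<in> pts G" "c r0"
  proof -
    obtain D where D: "D \<in> comps G" "r0 \<in> D" using comps_cover[OF r0(1)] by blast
    then have "f D = r0" using r0 by (simp add: f_def)
    then show ?thesis using D(1) by (intro image_eqI[of _ _ D]) auto
  qed
  moreover have "\<exists>!r. r \<in> f ` comps G \<and> (p, r) \<in> ?R" if p: "p \<in> pts G" for p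
  proof -
    obtain D where D: "D \<in> comps G" "p \<in> D" using comps_cover[OF p] by blast
    show ?thesis
    proof (rule ex1I[of _ "f D"])
      show "f D \<in> f ` comps G \<and> (p, f D) \<in> ?R"
        using D f[OF D(1)] comps_props(6)[OF wf D] by blast
      fix r assume r: "r \<in> f ` comps G \<and> (p, r) \<in> ?R"
      then obtain D' where D': "D' \<in> comps G" "r = f D'" by blast
      have "r \<in> D" using comps_props(6)[OF wf D] r by blast
      moreover have "r \<in> D'" using f[OF D'(1)] D'(2) by simp
      ultimately have "D = D'" using D_eq[OF D(1)] D_eq[OF D'(1)] by metis
      then show "r = f D" using D'(2) by simp
    qed
  qed
  ultimately show ?thesis by (intro exI[of _ "f ` comps G"]) simp
qed

lemma reach_nu_on_comps:
  assumes wf: "rgraph_wf G" and pq: "(p, q) \<in> reach (pts G) {sg G, nu_on G X}"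
  shows "(p, q) \<in> reach (pts G) {sg G, nu G, ep G}"
  using pq
proof (rule reach_mono_steps)
  fix y f assume y: "y \<in> pts G" and f: "f \<in> {sg G, nu_on G X}"
  have "(y, h y) \<in> reach (pts G) {sg G, nu G, ep G}" if "h \<in> {sg G, nu G, ep G}" for h
    by (rule reach_step[OF reach_refl y that])
  then show "(y, f y) \<in> reach (pts G) {sg G, nu G, ep G}"
    using f by (auto simp: nu_on_def)
qed

text \<open>Boundary orbits refine components. With exactly one root per component, orbits that all
  contain a root must share it within a component, so they coincide.\<close>

lemma qtree_iff_rooted:
  assumes wf: "rgraph_wf G" and Rt: "Rt \<subseteq> pts G"
    and uniq: "\<And>p. p \<in> pts G \<Longrightarrow> \<exists>!r. r \<in> Rt \<and> (p, r) \<in> reach (pts G) {sg G, nu G, ep G}"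
  shows "qtree G X \<longleftrightarrow> X \<subseteq> E G \<and> rooted (pts G) Rt {sg G, nu_on G X}"
proof -
  let ?R = "reach (pts G) {sg G, nu G, ep G}" and ?K = "reach (pts G) {sg G, nu_on G X}"
  note w = rgraph_wfD[OF wf]
  have fpf: "\<And>f. f \<in> {sg G, nu_on G X} \<Longrightarrow> fpf_inv_on (pts G) f" using w(2) nu_on_fpf[OF wf] by auto
  have "(\<forall>p\<in>pts G. \<forall>q\<in>pts G. (p, q) \<in> ?R \<longrightarrow> (p, q) \<in> ?K) \<longleftrightarrow> rooted (pts G) Rt {sg G, nu_on G X}"
  proof
    assume a: "\<forall>p\<in>pts G. \<forall>q\<in>pts G. (p, q) \<in> ?R \<longrightarrow> (p, q) \<in> ?K"
    show "rooted (pts G) Rt {sg G, nu_on G X}"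
      unfolding rooted_def
    proof
      fix p assume p: "p \<in> pts G"
      obtain r where "r \<in> Rt" "(p, r) \<in> ?R" using uniq[OF p] by blast
      then show "\<exists>r\<in>Rt. (p, r) \<in> ?K" using a p Rt by blast
    qed
  next
    assume a: "rooted (pts G) Rt {sg G, nu_on G X}"
    show "\<forall>p\<in>pts G. \<forall>q\<in>pts G. (p, q) \<in> ?R \<longrightarrow> (p, q) \<in> ?K"
    proof (intro ballI impI)
      fix p q assume p: "p \<in> pts G" and q: "q \<in> pts G" and pq: "(p, q) \<in> ?R"
      obtain r where r: "r \<in> Rt" "(p, r) \<in> ?K" using a p by (auto simp: rooted_def)
      obtain r' where r': "r' \<in> Rt" "(q, r') \<in> ?K" using a q by (auto simp: rooted_def)
      have "(p, r) \<in> ?R" "(p, r') \<in> ?R"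
        using reach_nu_on_comps[OF wf] r(2) r'(2) reach_trans[OF pq] by simp_all
      then have "r = r'" using uniq[OF p] r(1) r'(1) by blast
      then have "(r, q) \<in> ?K" using reach_sym[OF r'(2) q fpf] by simp
      then show "(p, q) \<in> ?K" by (rule reach_trans[OF r(2)])
    qed
  qed
  then show ?thesis using qtree_iff[OF wf] by simp
qed

section \<open>The indicator of quasi-trees as a determinant, and the resulting matrix\<close>

context
  fixes G :: "('p, 'e) rgraph" and c :: "'p \<Rightarrow> bool"
  assumes wf: "rgraph_wf G"
    and c_nu: "\<And>p. p \<in> pts G \<Longrightarrow> c (nu G p) \<noteq> c p" and c_ep: "\<And>p. p \<in> pts G \<Longrightarrow> c (ep G p) \<noteq> c p"
begin

lemma c_nu_on: "p \<in> pts G \<Longrightarrow> c (nu_on G X p) \<noteq> c p"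
  using c_nu c_ep by (simp add: nu_on_def)

text \<open>\<open>T\<close> and \<open>N\<close> are chosen before \<open>X\<close>;
  \<open>X\<close> enters only through the corner at which \<open>N\<close> is evaluated. This makes
  the passage between two sets a low-rank update.\<close>

lemma pencil_orientable:
  assumes c_sg: "\<And>p. p \<in> pts G \<Longrightarrow> c (sg G p) \<noteq> c p"
  shows "\<exists>T N. \<forall>X\<subseteq>E G. pdet (\<lambda>x z. T x z - N x (nu_on G X z)) {p \<in> pts G. c p} =
    (if qtree G X then 1 else 0)"
proof -
  note w = rgraph_wfD[OF wf]
  \<comment> \<open>No particular root is prescribed here, so \<open>r0\<close> is an arbitrary
    value.\<close>
  have "\<exists>Rt \<subseteq> {p \<in> pts G. c p}. (undefined \<in> pts G \<and> c undefined \<longrightarrow> undefined \<in> Rt) \<and>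
     (\<forall>p\<in>pts G. \<exists>!r. r \<in> Rt \<and> (p, r) \<in> reach (pts G) {sg G, nu G, ep G})"
    by (rule component_roots[OF wf]) (rule c_nu)
  then obtain Rt where Rt': "Rt \<subseteq> {p \<in> pts G. c p}"
    "\<forall>p\<in>pts G. \<exists>!r. r \<in> Rt \<and> (p, r) \<in> reach (pts G) {sg G, nu G, ep G}"
    by (elim exE conjE) (rule that)
  note Rt = Rt'(1) bspec[OF Rt'(2)]
  have sub: "Rt \<subseteq> pts G" using Rt(1) by blast
  show ?thesis
  proof (intro exI allI impI)
    fix X assume X: "X \<subseteq> E G"
    show "pdet (\<lambda>x z. (if x = z then 1 else 0) -
        (\<lambda>x y. if x \<notin> Rt \<and> sg G y = x then 1 else 0) x (nu_on G X z)) {p \<in> pts G. c p} =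
      (if qtree G X then 1 else 0)"
      using pdet_rooted[OF w(1,2) nu_on_fpf[OF wf], of c X Rt, OF c_sg c_nu_on Rt(1)]
        qtree_iff_rooted[OF wf sub Rt(2), of X] X by simp
  qed
qed

text \<open>For each \<open>X\<close> exactly one of the two reconnections has the same boundary components as the
  original graph, and the other one splits off a component without a root.  So the indicator of
  quasi-trees is a sum of two determinants that differ in row \<open>a\<close> only.\<close>
lemma pencil_twisted:
  assumes tw: "twisted_at (pts G) (sg G) c a b"
  shows "\<exists>T N. \<forall>X\<subseteq>E G. pdet (\<lambda>x z. T x z - N x (nu_on G X z)) {p \<in> pts G. c p} =
    (if qtree G X then 1 else 0)"
proof -
  note w = rgraph_wfD[OF wf]
  let ?P = "pts G" and ?I = "{p \<in> pts G. c p}" and ?R = "reach (pts G) {sg G, nu G, ep G}"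
  note t = twisted_points[OF w(2) tw]
  let ?s1 = "untwist (sg G) a b" and ?s2 = "untwist (sg G) a (sg G b)"
  note tw' = twisted_at_sym[OF w(2) tw]
  note u1 = untwist_apply[OF w(2) tw] and u2 = untwist_apply[OF w(2) tw', unfolded t(10)]
  have "\<exists>Rt \<subseteq> ?I. (sg G a \<in> ?P \<and> c (sg G a) \<longrightarrow> sg G a \<in> Rt) \<and>
     (\<forall>p\<in>?P. \<exists>!r. r \<in> Rt \<and> (p, r) \<in> ?R)"
    by (rule component_roots[OF wf]) (rule c_nu)
  then obtain Rt where Rt': "Rt \<subseteq> ?I" "sg G a \<in> ?P \<and> c (sg G a) \<longrightarrow> sg G a \<in> Rt"
    "\<forall>p\<in>?P. \<exists>!r. r \<in> Rt \<and> (p, r) \<in> ?R"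
    by (elim exE conjE) (rule that)
  note Rt = Rt'(1) mp[OF Rt'(2) conjI[OF t(3,6)]] bspec[OF Rt'(3)]
  have sub: "Rt \<subseteq> ?P" using Rt(1) by blast
  have a_sga: "(a, sg G a) \<in> ?R" by (rule reach_step[OF reach_refl t(1)]) simp
  have root_a: "r = sg G a" if "r \<in> Rt" "(a, r) \<in> ?R" for r
    using Rt(3)[OF t(1)] that Rt(2) a_sga by blast
  have aRt: "a \<notin> Rt" using root_a[of a] t(11) by auto
  \<comment> \<open>Off row \<open>a\<close> both reconnections give the same matrix on coloured
    indices: they differ by exchanging \<open>a\<close> and \<open>sg G a\<close>, and row
    \<open>sg G a\<close> belongs to a root. Adding the two rows \<open>a\<close> explains the
    diagonal entry 2.\<close>
  have det: "pdet (\<lambda>x z. (if x = z then if x = a then 2 else 1 else 0) -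
        ((if x \<notin> Rt \<and> ?s1 (nu_on G X z) = x then 1 else 0) + (if x = a \<and> ?s2 (nu_on G X z) = a then 1 else 0))) ?I =
      (if qtree G X then 1 else 0)" (is "pdet ?S ?I = _") if X: "X \<subseteq> E G" for X
  proof -
    let ?n = "nu_on G X"
    note n = nu_on_fpf[OF wf, of X]
    have nP: "?n z \<in> ?P" "\<not> c (?n z)" if "z \<in> ?I" for z
      using n that c_nu_on[of z X] by (auto simp: fpf_inv_on_def)
    let ?S1 = "\<lambda>x z. (if x = z then 1 else 0) - (if x \<notin> Rt \<and> ?s1 (?n z) = x then 1 else 0) :: int"
    let ?S2 = "\<lambda>x z. (if x = z then 1 else 0) - (if x \<notin> Rt \<and> ?s2 (?n z) = x then 1 else 0) :: int"
    \<comment> \<open>The second reconnection is the first followed by the transposition of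
      \<open>a\<close> and \<open>sg G a\<close>. It suffices to check this at uncoloured corners,
      as \<open>?n z\<close> is one.\<close>
    have s12: "?s2 (?n z) = (if ?s1 (?n z) = a then sg G a else if ?s1 (?n z) = sg G a then a else ?s1 (?n z))"
      if z: "z \<in> ?I" for z
    proof (cases "?n z \<in> {b, sg G b}")
      case True
      then have "?n z = b \<or> ?n z = sg G b" by simp
      then show ?thesis using t(11) by (elim disjE) (simp_all add: u1 u2)
    next
      case False
      then have z': "?n z \<notin> {a, sg G a, b, sg G b}" using nP[OF z] t(5,6) by auto
      then have "?s1 (?n z) = sg G (?n z)" "?s2 (?n z) = sg G (?n z)" using u1(5) u2(5) by auto
      moreover have "sg G (?n z) \<notin> {a, sg G a, b, sg G b}"
        by (rule twisted_other(2)[OF w(2) tw nP(1)[OF z] z'])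
      ultimately show ?thesis by simp
    qed
    have fin: "finite ?I" using w(1) by simp
    have "pdet ?S ?I = pdet ?S1 ?I + pdet ?S2 ?I"
    proof (rule pdet_row_add[OF fin, of a])
      show "a \<in> ?I" using t by simp
      show "?S a j = ?S1 a j + ?S2 a j" for j using aRt by simp
      show "?S1 i j = ?S i j" if "i \<noteq> a" for i j using that by simp
      show "?S2 i j = ?S i j" if "i \<noteq> a" "j \<in> ?I" for i j
        using that s12[OF that(2)] Rt(2) by auto
    qed
    also have "pdet ?S1 ?I = (if rooted ?P Rt {?s1, ?n} then 1 else 0)"
      by (rule pdet_rooted[OF w(1) untwist_fpf[OF w(2) tw] n, of c, OF untwist_flips[OF w(2) tw] c_nu_on Rt(1)])
    also have "pdet ?S2 ?I = (if rooted ?P Rt {?s2, ?n} then 1 else 0)"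
      by (rule pdet_rooted[OF w(1) untwist_fpf[OF w(2) tw'] n, of c, OF untwist_flips[OF w(2) tw'] c_nu_on Rt(1)])
    finally have det: "pdet ?S ?I = (if rooted ?P Rt {?s1, ?n} then 1 else 0) + (if rooted ?P Rt {?s2, ?n} then 1 else 0)" .
    let ?K = "reach ?P {sg G, ?n}" and ?K1 = "reach ?P {?s1, ?n}" and ?K2 = "reach ?P {?s2, ?n}"
    have sub1: "(p, q) \<in> ?K" if "(p, q) \<in> ?K1" for p q
      by (rule untwist_reach[OF w(2) tw n w(1) c_nu_on that])
    have sub2: "(p, q) \<in> ?K" if "(p, q) \<in> ?K2" for p q
      by (rule untwist_reach[OF w(2) tw' n w(1) c_nu_on that])
    \<comment> \<open>The two permutations of the coloured corners differ by a transposition, so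
      exactly one of them has \<open>a\<close> and \<open>sg G a\<close> on a common cycle.\<close>
    have excl: "(a, sg G a) \<in> ?K1 \<longleftrightarrow> (a, sg G a) \<notin> ?K2"
    proof -
      have "(a, sg G a) \<in> ?K1 \<longleftrightarrow> (\<exists>k. ((\<lambda>x. ?s1 (?n x)) ^^ k) a = sg G a)"
        by (rule reach_same_colour[OF w(1) untwist_fpf[OF w(2) tw] n, of c, OF untwist_flips[OF w(2) tw] c_nu_on t(1,5,6)])
      moreover have "(a, sg G a) \<in> ?K2 \<longleftrightarrow> (\<exists>k. ((\<lambda>x. ?s2 (?n x)) ^^ k) a = sg G a)"
        by (rule reach_same_colour[OF w(1) untwist_fpf[OF w(2) tw'] n, of c, OF untwist_flips[OF w(2) tw'] c_nu_on t(1,5,6)])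
      moreover have "(\<exists>k. ((\<lambda>x. ?s1 (?n x)) ^^ k) a = sg G a) \<longleftrightarrow>
          \<not> (\<exists>k. ((\<lambda>x. ?s2 (?n x)) ^^ k) a = sg G a)"
        by (rule transposition_separates[OF fin
              tau_on_colour[OF w(1) untwist_fpf[OF w(2) tw] n, of c, OF untwist_flips[OF w(2) tw] c_nu_on]])
           (use t s12 in auto)
      ultimately show ?thesis by simp
    qed
    \<comment> \<open>The only root in the component of \<open>a\<close> is \<open>sg G a\<close>,
      so a rooted reconnection has to join them.\<close>
    have need: "(a, sg G a) \<in> reach ?P {s, ?n}" if root: "rooted ?P Rt {s, ?n}"
      and s: "\<And>p q. (p, q) \<in> reach ?P {s, ?n} \<Longrightarrow> (p, q) \<in> ?K" for s
    proof -
      obtain r where r: "r \<in> Rt" "(a, r) \<in> reach ?P {s, ?n}" using root t(1) by (auto simp: rooted_def)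
      then show ?thesis using root_a[OF r(1) reach_nu_on_comps[OF wf s[OF r(2)]]] by simp
    qed
    have up1: "rooted ?P Rt {sg G, ?n}" if "rooted ?P Rt {?s1, ?n}"
      using that sub1 unfolding rooted_def by meson
    have up2: "rooted ?P Rt {sg G, ?n}" if "rooted ?P Rt {?s2, ?n}"
      using that sub2 unfolding rooted_def by meson
    have down1: "rooted ?P Rt {?s1, ?n}" if "rooted ?P Rt {sg G, ?n}" "(a, sg G a) \<in> ?K1"
      using that(1) reach_untwist[OF w(2) tw n that(2)] unfolding rooted_def by meson
    have down2: "rooted ?P Rt {?s2, ?n}" if "rooted ?P Rt {sg G, ?n}" "(a, sg G a) \<in> ?K2"
      using that(1) reach_untwist[OF w(2) tw' n that(2)] unfolding rooted_def by meson
    have n1: "(a, sg G a) \<in> ?K1" if "rooted ?P Rt {?s1, ?n}"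
      by (rule need[OF that]) (rule sub1)
    have n2: "(a, sg G a) \<in> ?K2" if "rooted ?P Rt {?s2, ?n}"
      by (rule need[OF that]) (rule sub2)
    have "rooted ?P Rt {sg G, ?n} \<longleftrightarrow> rooted ?P Rt {?s1, ?n} \<or> rooted ?P Rt {?s2, ?n}"
      using excl up1 up2 down1 down2 by blast
    moreover have "\<not> (rooted ?P Rt {?s1, ?n} \<and> rooted ?P Rt {?s2, ?n})"
      using excl n1 n2 by blast
    ultimately have "pdet ?S ?I = (if rooted ?P Rt {sg G, ?n} then 1 else 0)"
      unfolding det by simp
    then show ?thesis using qtree_iff_rooted[OF wf sub Rt(3), of X] X by simp
  qed
  show ?thesis
    by (rule exI[of _ "\<lambda>x z. if x = z then if x = a then 2 else 1 else 0"],
        rule exI[of _ "\<lambda>x y. (if x \<notin> Rt \<and> ?s1 y = x then 1 else 0) + (if x = a \<and> ?s2 y = a then 1 else 0)"])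
       (intro allI impI, rule det)
qed

text \<open>Passing from \<open>Q\<close> to \<open>X\<close> swaps the \<open>nu\<close>-partners of the two coloured corners \<open>u e\<close>, \<open>v e\<close>
  of every edge of the symmetric difference: a sum of rank-one updates, one for each such edge.\<close>
lemma matrix_of_pencil:
  fixes T N :: "'p \<Rightarrow> 'p \<Rightarrow> int"
  assumes det: "\<forall>X\<subseteq>E G. pdet (\<lambda>x z. T x z - N x (nu_on G X z)) {p \<in> pts G. c p} =
      (if qtree G X then 1 else 0)"
    and Q: "qtree G Q"
  shows "\<exists>M :: 'e \<Rightarrow> 'e \<Rightarrow> int. \<forall>X\<subseteq>E G. pdet M ((Q - X) \<union> (X - Q)) = (if qtree G X then 1 else 0)"
proof -
  note w = rgraph_wfD[OF wf]
  let ?I = "{p \<in> pts G. c p}"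
  have QE: "Q \<subseteq> E G" using Q by (simp add: qtree_def)
  have "\<exists>p\<in>?I. edg G p = e" if e: "e \<in> E G" for e
  proof -
    obtain p where p: "p \<in> pts G" "edg G p = e" using e by (auto simp: E_def)
    have "nu G p \<in> pts G" "edg G (nu G p) = e" using w(3,5) p by (auto simp: fpf_inv_on_def)
    then show ?thesis using p c_nu[OF p(1)] by blast
  qed
  then obtain u where u: "\<And>e. e \<in> E G \<Longrightarrow> u e \<in> ?I" "\<And>e. e \<in> E G \<Longrightarrow> edg G (u e) = e"
    by metis
  \<comment> \<open>\<open>nu\<close> and \<open>ep\<close> both change the colour, so the second
    coloured corner of \<open>e\<close> is the one opposite to \<open>u e\<close>.\<close>
  define v where "v e = ep G (nu G (u e))" for e
  define W where "W x e = N x (nu_on G Q (u e)) - N x (nu_on G Q (v e))" for x e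
  define V where "V e z = (if z = u e then 1 else 0) - (if z = v e then 1 else 0 :: int)" for e z
  have upd: "T x z - N x (nu_on G X z) =
      (T x z - N x (nu_on G Q z)) + (\<Sum>e\<in>(Q - X) \<union> (X - Q). W x e * V e z)"
    if X: "X \<subseteq> E G" and z: "z \<in> ?I" for X x z
  proof -
    let ?Y = "(Q - X) \<union> (X - Q)" and ?e = "edg G z"
    have finY: "finite ?Y"
      using finite_subset[of ?Y "E G"] X QE w(1) by (auto simp: E_def)
    have e: "?e \<in> E G" using z by (auto simp: E_def)
    have uP: "u ?e \<in> pts G" "c (u ?e)" "edg G (u ?e) = ?e" using u[OF e] by auto
    have inv: "nu G p \<in> pts G" "ep G p \<in> pts G" "nu G (nu G p) = p" "ep G (ep G p) = p"
      if "p \<in> pts G" for p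
      using w(3,4) that by (auto simp: fpf_inv_on_def)
    have vP: "v ?e \<in> pts G" "edg G (v ?e) = ?e" "nu G (v ?e) = ep G (u ?e)" "ep G (v ?e) = nu G (u ?e)"
      using uP inv w(5,6) w(7)[of "nu G (u ?e)"] by (auto simp: v_def)
    have uv: "u ?e \<noteq> v ?e"
      using edge_points(2)[OF wf uP(1)] w(7)[OF uP(1)] by (auto simp: v_def)
    have z_cases: "z = u ?e \<or> z = v ?e"
    proof -
      have "z \<in> {q \<in> pts G. edg G q = edg G (u ?e)}" using z uP by simp
      then have "z \<in> {u ?e, nu G (u ?e), ep G (u ?e), nu G (ep G (u ?e))}"
        unfolding edge_points(1)[OF wf uP(1)] .
      then show ?thesis
        using z uP c_nu[OF uP(1)] c_ep[OF uP(1)] w(7)[OF uP(1)] by (auto simp: v_def)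
    qed
    have zero: "V e z = 0" if "e \<in> E G" "e \<noteq> ?e" for e
    proof -
      have "edg G (u e) = e" "edg G (v e) = e" using u[OF that(1)] w(5,6) inv by (auto simp: v_def)
      then show ?thesis using that(2) by (auto simp: V_def)
    qed
    have "(\<Sum>e\<in>?Y. W x e * V e z) = (\<Sum>e\<in>?Y. if e = ?e then W x ?e * V ?e z else 0)"
      using X QE zero by (intro sum.cong) auto
    also have "\<dots> = (if ?e \<in> ?Y then W x ?e * V ?e z else 0)"
      using finY by simp
    finally have sum: "(\<Sum>e\<in>?Y. W x e * V e z) = (if ?e \<in> ?Y then W x ?e * V ?e z else 0)" .
    show ?thesis
    proof (cases "?e \<in> ?Y")
      case False
      then have "nu_on G X z = nu_on G Q z" by (auto simp: nu_on_def)
      then show ?thesis unfolding sum using False by auto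
    next
      case True
      have XQ: "?e \<in> X \<longleftrightarrow> ?e \<notin> Q" using True by auto
      have "nu_on G X (u ?e) = nu_on G Q (v ?e)" "nu_on G X (v ?e) = nu_on G Q (u ?e)"
        using XQ uP vP by (simp_all add: nu_on_def)
      then show ?thesis unfolding sum using True z_cases uv by (auto simp: W_def V_def)
    qed
  qed
  have fin: "finite ?I" using w(1) by simp
  \<comment> \<open>Here the quasi-tree \<open>Q\<close> enters: the matrix at \<open>Q\<close> is
    unimodular, as the low-rank update requires.\<close>
  have "pdet (\<lambda>x z. T x z - N x (nu_on G Q z)) ?I = 1" using det QE Q by simp
  from pdet_low_rank_update[OF fin this, of W V]
  obtain M where M: "\<And>Y. finite Y \<Longrightarrow> pdet M Y =
      pdet (\<lambda>x z. (T x z - N x (nu_on G Q z)) + (\<Sum>e\<in>Y. W x e * V e z)) ?I" by blast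
  have "pdet M ((Q - X) \<union> (X - Q)) = (if qtree G X then 1 else 0)" if X: "X \<subseteq> E G" for X
  proof -
    have "finite ((Q - X) \<union> (X - Q))"
      using finite_subset[of "(Q - X) \<union> (X - Q)" "E G"] X QE w(1) by (auto simp: E_def)
    from M[OF this] have "pdet M ((Q - X) \<union> (X - Q)) = pdet (\<lambda>x z. T x z - N x (nu_on G X z)) ?I"
      using upd[OF X] by (auto intro!: pdet_cong)
    then show ?thesis using det X by simp
  qed
  then show ?thesis by blast
qed

end

section \<open>Principal unimodularity and the number of quasi-trees\<close>

theorem theorem1p2:
  fixes G :: "('p, 'e) rgraph" and Q :: "'e set"
  assumes "rgraph_wf G" and "pseudo_orientable G" and "qtree G Q"
  shows "\<exists>M :: 'e \<Rightarrow> 'e \<Rightarrow> int.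
           principally_unimodular M (E G)
         \<and> (\<forall>X\<subseteq>E G. pdet M ((Q - X) \<union> (X - Q)) = (if qtree G X then 1 else 0))
         \<and> pdet (\<lambda>i j. (if i = j then 1 else 0) + M i j) (E G)
             = int (card {X. X \<subseteq> E G \<and> qtree G X})"
proof -
  obtain c :: "'p \<Rightarrow> bool" where c: "\<forall>p\<in>pts G. c (nu G p) \<noteq> c p \<and> c (ep G p) \<noteq> c p"
    and tw: "(\<forall>p\<in>pts G. c (sg G p) \<noteq> c p) \<or>
      (\<exists>a b. twisted_at (pts G) (sg G) c a b)"
    using pseudo_orientable_colouring[OF assms(1,2)] by (elim conjE exE) (rule that)
  have c_nu: "\<And>p. p \<in> pts G \<Longrightarrow> c (nu G p) \<noteq> c p" and c_ep: "\<And>p. p \<in> pts G \<Longrightarrow> c (ep G p) \<noteq> c p"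
    using c by simp_all
  have "\<exists>T N. \<forall>X\<subseteq>E G. pdet (\<lambda>x z. T x z - N x (nu_on G X z)) {p \<in> pts G. c p} =
      (if qtree G X then 1 else 0)"
    using tw
  proof (elim disjE exE conjE)
    assume "\<forall>p\<in>pts G. c (sg G p) \<noteq> c p"
    then show ?thesis by (intro pencil_orientable[OF assms(1), of c, OF c_nu c_ep]) simp_all
  next
    fix a b assume "twisted_at (pts G) (sg G) c a b"
    then show ?thesis by (intro pencil_twisted[OF assms(1), of c, OF c_nu c_ep])
  qed
  then obtain T N where "\<forall>X\<subseteq>E G. pdet (\<lambda>x z. T x z - N x (nu_on G X z)) {p \<in> pts G. c p} =
      (if qtree G X then 1 else 0)" by (elim exE)
  from matrix_of_pencil[OF assms(1), of c, OF c_nu c_ep this assms(3)]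
  obtain M :: "'e \<Rightarrow> 'e \<Rightarrow> int" where
    M: "\<forall>X\<subseteq>E G. pdet M ((Q - X) \<union> (X - Q)) = (if qtree G X then 1 else 0)"
    by (rule exE)
  have QE: "Q \<subseteq> E G" using assms(3) by (simp add: qtree_def)
  have fin: "finite (E G)" using rgraph_wfD(1)[OF assms(1)] by (simp add: E_def)
  let ?d = "\<lambda>X. (Q - X) \<union> (X - Q)"
  \<comment> \<open>Symmetric difference with \<open>Q\<close> is an involution, so every
    \<open>Y\<close> arises from some \<open>X\<close> and all principal minors are covered by
    \<open>M\<close>.\<close>
  have dd: "?d (?d X) = X" for X by blast
  have "principally_unimodular M (E G)"
    unfolding principally_unimodular_def
  proof (intro allI impI)
    fix Y assume "Y \<subseteq> E G"
    then have "?d Y \<subseteq> E G" using QE by blast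
    then show "pdet M Y \<in> {-1, 0, 1}" using M dd[of Y] by (metis insertCI)
  qed
  moreover have "pdet (\<lambda>i j. (if i = j then 1 else 0) + M i j) (E G) = int (card {X. X \<subseteq> E G \<and> qtree G X})"
  proof -
    \<comment> \<open>The same involution turns the sum of all principal minors into a sum of
      quasi-tree indicators.\<close>
    have "bij_betw ?d (Pow (E G)) (Pow (E G))"
      by (rule bij_betw_byWitness[of _ ?d]) (use QE in blast)+
    then have "(\<Sum>Y\<in>Pow (E G). pdet M Y) = (\<Sum>X\<in>Pow (E G). pdet M (?d X))"
      by (rule sum.reindex_bij_betw[symmetric])
    also have "\<dots> = (\<Sum>X\<in>Pow (E G). if qtree G X then 1 else 0)"
      using M by (intro sum.cong) auto
    also have "\<dots> = int (card (Pow (E G) \<inter> {X. qtree G X}))"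
      using fin by (simp add: sum.If_cases)
    also have "Pow (E G) \<inter> {X. qtree G X} = {X. X \<subseteq> E G \<and> qtree G X}" by blast
    finally show ?thesis by (simp add: pdet_one_plus[OF fin])
  qed
  ultimately show ?thesis using M by blast
qed

end
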